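(* Let $\rho^{AB}$ be a density operator on $\mathcal{H}_A\otimes\mathcal{H}_B$. Then $$D(A|B)\le S(B),$$ with equality if and only if there exists a decomposition of $\mathcal{H}_A$ as a tensor product $\mathcal{H}_{A^L}\otimes\mathcal{H}_{A^R}$ such that $$\rho^{AB}=\rho^{A^L}\otimes|\psi\rangle\langle\psi|^{A^RB}$$ for some density operator $\rho^{A^L}$ on $\mathcal{H}_{A^L}$ and some unit vector $|\psi\rangle\in\mathcal{H}_{A^R}\otimes\mathcal{H}_B$.
   Context: All Hilbert spaces are finite-dimensional complex Hilbert spaces. A state is a density operator (positive semidefinite, trace one). Superscripts denote reduced states, e.g. $\rho^B=\mathrm{Tr}_A\rho^{AB}$. The von Neumann entropy is $S(X)=-\mathrm{Tr}\,\rho^X\log_2\rho^X$. The mutual information is $I(A:B)=S(A)+S(B)-S(AB)$. The classical correlation (with measurement on $B$) is $$J(A|B)=\max_{\{E_i^B\}}\Big(S(A)-\sum_i p_i\,S(A|E_i^B)\Big),$$ where the maximum is over all POVMs $\{E_i^B\}$ on $\mathcal{H}_B$, $p_i=\mathrm{Tr}\big((I\otimes E_i^B)\rho^{AB}\big)$, and $S(A|E_i^B)$ is the von Neumann entropy of the post-measurement state $\rho_i^A=\mathrm{Tr}_B\big((I\otimes E_i^B)\rho^{AB}\big)/p_i$ (terms with $p_i=0$ are omitted). The quantum discord (with measurement on $B$) is $D(A|B)=I(A:B)-J(A|B)$.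
   Formalization: The equality criterion fails for some states whose reduced state on A lacks full support (e.g. dim A = 5), so equality is characterized by a tensor decomposition of a subspace of H_A; the criterion with H_A itself is proved when the reduced state on A is invertible. *)

theory Defs
  imports "Jordan_Normal_Form.Schur_Decomposition"
begin

text \<open>
  A Hilbert space of dimension n is \<open>carrier_vec n\<close> over the complex numbers, its operators are
  \<open>carrier_mat n n\<close>. The tensor product of spaces of dimensions m and n has dimension m * n, the
  basis vector number \<open>i * n + k\<close> being the tensor product of the basis vectors number i and k.
  With this ordering the Kronecker product is strictly associative.
\<close>

definition kron :: "complex mat \<Rightarrow> complex mat \<Rightarrow> complex mat" where
  "kron X Y = mat (dim_row X * dim_row Y) (dim_col X * dim_col Y)
     (\<lambda>(i, j). X $$ (i div dim_row Y, j div dim_col Y) * Y $$ (i mod dim_row Y, j mod dim_col Y))"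

definition ptrace_A :: "nat \<Rightarrow> nat \<Rightarrow> complex mat \<Rightarrow> complex mat" where
  "ptrace_A dA dB X = mat dB dB (\<lambda>(i, j). \<Sum>k<dA. X $$ (k * dB + i, k * dB + j))"

definition ptrace_B :: "nat \<Rightarrow> nat \<Rightarrow> complex mat \<Rightarrow> complex mat" where
  "ptrace_B dA dB X = mat dA dA (\<lambda>(i, j). \<Sum>k<dB. X $$ (i * dB + k, j * dB + k))"

definition mat_trace :: "complex mat \<Rightarrow> complex" where
  "mat_trace X = (\<Sum>i<dim_row X. X $$ (i, i))"

definition isometry_mat :: "complex mat \<Rightarrow> bool" where
  "isometry_mat V \<longleftrightarrow> mat_adjoint V * V = 1\<^sub>m (dim_col V)"

definition unitary_mat :: "nat \<Rightarrow> complex mat \<Rightarrow> bool" where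
  "unitary_mat n U \<longleftrightarrow> U \<in> carrier_mat n n \<and>
     mat_adjoint U * U = 1\<^sub>m n \<and> U * mat_adjoint U = 1\<^sub>m n"

definition psd_mat :: "nat \<Rightarrow> complex mat \<Rightarrow> bool" where
  "psd_mat n X \<longleftrightarrow> X \<in> carrier_mat n n \<and> mat_adjoint X = X \<and>
     (\<forall>v \<in> carrier_vec n. 0 \<le> Re ((X *\<^sub>v v) \<bullet>c v))"

definition density_mat :: "nat \<Rightarrow> complex mat \<Rightarrow> bool" where
  "density_mat n \<rho> \<longleftrightarrow> psd_mat n \<rho> \<and> mat_trace \<rho> = 1"

definition unit_vector :: "nat \<Rightarrow> complex vec \<Rightarrow> bool" where
  "unit_vector n \<psi> \<longleftrightarrow> \<psi> \<in> carrier_vec n \<and> \<psi> \<bullet>c \<psi> = 1"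

definition ket_bra :: "complex vec \<Rightarrow> complex mat" where
  "ket_bra \<psi> = mat (dim_vec \<psi>) (dim_vec \<psi>) (\<lambda>(i, j). \<psi> $ i * cnj (\<psi> $ j))"

text \<open>
  Functional calculus for Hermitian X. The matrix is unique: it does not depend on the choice of the
  unitary diagonalization of X.
\<close>

definition mat_fun :: "(real \<Rightarrow> real) \<Rightarrow> complex mat \<Rightarrow> complex mat" where
  "mat_fun f X = (SOME Y. \<exists>U d. unitary_mat (dim_row X) U \<and>
     X = U * mat_diag (dim_row X) (\<lambda>i. complex_of_real (d i)) * mat_adjoint U \<and>
     Y = U * mat_diag (dim_row X) (\<lambda>i. complex_of_real (f (d i))) * mat_adjoint U)"

text \<open>
  The convention 0 * log 0 = 0 is respected, since \<open>log 2 0 = 0\<close> in HOL.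
\<close>

definition entropy :: "complex mat \<Rightarrow> real" where
  "entropy \<rho> = - Re (mat_trace (\<rho> * mat_fun (log 2) \<rho>))"

definition mutual_information :: "nat \<Rightarrow> nat \<Rightarrow> complex mat \<Rightarrow> real" where
  "mutual_information dA dB \<rho> =
     entropy (ptrace_B dA dB \<rho>) + entropy (ptrace_A dA dB \<rho>) - entropy \<rho>"

definition povm :: "nat \<Rightarrow> nat \<Rightarrow> (nat \<Rightarrow> complex mat) \<Rightarrow> bool" where
  "povm d n E \<longleftrightarrow> (\<forall>i<n. psd_mat d (E i)) \<and>
     mat d d (\<lambda>(r, c). \<Sum>i<n. E i $$ (r, c)) = 1\<^sub>m d"

definition outcome_prob :: "nat \<Rightarrow> complex mat \<Rightarrow> complex mat \<Rightarrow> real" where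
  "outcome_prob dA \<rho> M = Re (mat_trace (kron (1\<^sub>m dA) M * \<rho>))"

definition post_state :: "nat \<Rightarrow> nat \<Rightarrow> complex mat \<Rightarrow> complex mat \<Rightarrow> complex mat" where
  "post_state dA dB \<rho> M =
     complex_of_real (1 / outcome_prob dA \<rho> M) \<cdot>\<^sub>m ptrace_B dA dB (kron (1\<^sub>m dA) M * \<rho>)"

definition information_gain ::
    "nat \<Rightarrow> nat \<Rightarrow> complex mat \<Rightarrow> nat \<Rightarrow> (nat \<Rightarrow> complex mat) \<Rightarrow> real" where
  "information_gain dA dB \<rho> n E = entropy (ptrace_B dA dB \<rho>) -
     (\<Sum>i \<in> {i. i < n \<and> outcome_prob dA \<rho> (E i) \<noteq> 0}.
        outcome_prob dA \<rho> (E i) * entropy (post_state dA dB \<rho> (E i)))"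

text \<open>
  The maximum over all POVMs, with any finite number n of outcomes. The set below is nonempty and
  bounded by the entropy of the reduced state on A, and its supremum is attained.
\<close>

definition classical_correlation :: "nat \<Rightarrow> nat \<Rightarrow> complex mat \<Rightarrow> real" where
  "classical_correlation dA dB \<rho> = Sup {information_gain dA dB \<rho> n E | n E. povm dB n E}"

definition discord :: "nat \<Rightarrow> nat \<Rightarrow> complex mat \<Rightarrow> real" where
  "discord dA dB \<rho> = mutual_information dA dB \<rho> - classical_correlation dA dB \<rho>"

text \<open>
  Identification, through V, of the tensor product of spaces L and R of dimensions dL and dR with the
  space A, respectively with a subspace of A. The latter is needed when the reduced state on A does
  not have full support: for instance, 5-dimensional A has no decomposition into two 2-dimensional
  factors, but 4-dimensional subspaces of A do.
\<close>

definition tensor_decomposition :: "nat \<Rightarrow> nat \<Rightarrow> nat \<Rightarrow> complex mat \<Rightarrow> bool" where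
  "tensor_decomposition dA dL dR V \<longleftrightarrow> dA = dL * dR \<and> unitary_mat dA V"

definition subspace_tensor_decomposition :: "nat \<Rightarrow> nat \<Rightarrow> nat \<Rightarrow> complex mat \<Rightarrow> bool" where
  "subspace_tensor_decomposition dA dL dR V \<longleftrightarrow> V \<in> carrier_mat dA (dL * dR) \<and> isometry_mat V"

text \<open>
  Under the identification V of the tensor product of L and R with (a subspace of) A, the state
  \<open>\<rho>\<close> on A and B is a product of a state on L and a pure state on R and B.
\<close>

definition state_times_pure ::
    "nat \<Rightarrow> nat \<Rightarrow> nat \<Rightarrow> complex mat \<Rightarrow> complex mat \<Rightarrow> bool" where
  "state_times_pure dL dR dB V \<rho> \<longleftrightarrow>
     (\<exists>\<sigma> \<psi>. density_mat dL \<sigma> \<and> unit_vector (dR * dB) \<psi> \<and>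
        \<rho> = kron V (1\<^sub>m dB) * kron \<sigma> (ket_bra \<psi>) * mat_adjoint (kron V (1\<^sub>m dB)))"

end

theory Submission
  imports Defs "Jordan_Normal_Form.Spectral_Radius"
begin

text \<open>
  Write \<open>\<rho> = \<Sum>k. l k |v k><v k|\<close> with all \<open>l k > 0\<close>. The bound says that some measurement satisfies
  \<open>\<Sum>i. p i * S (A|E i) \<le> S (AB)\<close>. Measuring B in an orthonormal basis leaves on A an unnormalized mixture
  of vectors whose Gram matrices sum to \<open>diag l\<close> over the outcomes. A state and its Gram matrix have
  the same entropy, and Klein's inequality compares it with \<open>- \<Sum>k. G k k * log (l k)\<close>; summed over the
  outcomes this gives \<open>S (AB)\<close>.

  If the discord is maximal, then Klein's inequality is an equality for every outcome of every
  orthonormal basis, so all the Gram matrices are multiples of \<open>diag l\<close>. Since any Hermitian matrix is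
  diagonal in some basis, this means that B is uncorrelated with the system purifying AB, and A
  splits accordingly. Conversely, measuring B in \<open>\<sigma> \<otimes> |\<psi>><\<psi>|\<close> leaves \<open>\<sigma> \<otimes> \<tau>\<close>, of entropy at least
  \<open>S \<sigma> = S (AB)\<close>.
\<close>

section \<open>Spectral theorem\<close>

text \<open>The supremum is never evaluated at a maximizer. The discord is S(B) + S(A) - S(AB) minus
  the supremum: a single basis gives the bound, and equality says that no measurement gains more
  than S(A) - S(AB), while every orthonormal basis gains at least that much. Hence equality holds in
  all bases at once, which is what polarization needs.

  The states left on A by different outcomes are hard to compare; their Gram matrices are indexed by
  \<open>k\<close> and all act on one space, that of the purifying system. Klein's inequality
  against a fixed matrix there has a right-hand side linear in the Gram matrix, so by Parseval the
  outcomes sum to the same value whatever the basis. Only eigenvectors of positive weight are kept,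
  so no condition on supports enters.

  \<open>entropy\<close> rests on a Hilbert choice among diagonalizations. It becomes computable
  through \<open>entropy_orthogonal_sum\<close>, which accepts any decomposition into orthogonal
  vectors, zero vectors included.\<close>

lemma mat_adjoint_dim [simp]:
  "dim_row (mat_adjoint A) = dim_col A" "dim_col (mat_adjoint A) = dim_row A"
  unfolding mat_adjoint_def by auto

lemma mat_adjoint_index [simp]:
  "i < dim_col A \<Longrightarrow> j < dim_row A \<Longrightarrow> mat_adjoint A $$ (i, j) = cnj (A $$ (j, i))"
  for A :: "complex mat"
  unfolding mat_adjoint_def by (simp add: mat_of_rows_def)

lemma mat_adjoint_carrier [simp, intro]:
  "A \<in> carrier_mat n m \<Longrightarrow> mat_adjoint A \<in> carrier_mat m n"
  by (auto intro: carrier_matI)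

lemma mat_mult_index:
  "A \<in> carrier_mat n m \<Longrightarrow> B \<in> carrier_mat m l \<Longrightarrow> i < n \<Longrightarrow> j < l \<Longrightarrow>
    (A * B) $$ (i, j) = (\<Sum>k<m. A $$ (i, k) * B $$ (k, j))"
  by (simp add: scalar_prod_def lessThan_atLeast0)

lemma sum_delta_lessThan:
  "a < n \<Longrightarrow> (\<Sum>i<(n::nat). (if i = a then 1 else 0) * f i) = (f a :: complex)"
  "a < n \<Longrightarrow> (\<Sum>i<(n::nat). (if a = i then 1 else 0) * f i) = (f a :: complex)"
  "a < n \<Longrightarrow> (\<Sum>i<(n::nat). f i * (if i = a then 1 else 0)) = (f a :: complex)"
  "a < n \<Longrightarrow> (\<Sum>i<(n::nat). f i * (if a = i then 1 else 0)) = (f a :: complex)"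
  by (simp_all add: if_distrib if_distribR sum.delta sum.delta' cong: if_cong)

lemma sum_rotate:
  "(\<Sum>a\<in>A. \<Sum>b\<in>B. \<Sum>k\<in>C. f a b k) = (\<Sum>k\<in>C. \<Sum>a\<in>A. \<Sum>b\<in>B. f a b k)"
proof -
  have "(\<Sum>a\<in>A. \<Sum>b\<in>B. \<Sum>k\<in>C. f a b k) = (\<Sum>a\<in>A. \<Sum>k\<in>C. \<Sum>b\<in>B. f a b k)"
    by (intro sum.cong refl sum.swap)
  also have "\<dots> = (\<Sum>k\<in>C. \<Sum>a\<in>A. \<Sum>b\<in>B. f a b k)" by (rule sum.swap)
  finally show ?thesis .
qed

text \<open>Vectors are functions of which only the first \<open>n\<close> values matter, which
  avoids the dimension side conditions of \<open>carrier_vec\<close>. The form is linear in the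
  first argument, like \<open>\<bullet>c\<close>.\<close>

definition cip :: "nat \<Rightarrow> (nat \<Rightarrow> complex) \<Rightarrow> (nat \<Rightarrow> complex) \<Rightarrow> complex" where
  "cip n x y = (\<Sum>a<n. x a * cnj (y a))"

definition onb :: "nat \<Rightarrow> (nat \<Rightarrow> nat \<Rightarrow> complex) \<Rightarrow> bool" where
  "onb n u \<longleftrightarrow> (\<forall>i<n. \<forall>j<n. cip n (u i) (u j) = (if i = j then 1 else 0)) \<and>
     (\<forall>a<n. \<forall>b<n. (\<Sum>i<n. u i a * cnj (u i b)) = (if a = b then 1 else 0))"

lemma cnj_cip: "cnj (cip n x y) = cip n y x"
  by (simp add: cip_def mult.commute)

lemma cip_self: "cip n x x = complex_of_real (\<Sum>a<n. (cmod (x a))\<^sup>2)"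
  by (simp add: cip_def complex_norm_square[symmetric])

lemma onb_orthonormal:
  "onb n u \<Longrightarrow> i < n \<Longrightarrow> j < n \<Longrightarrow> cip n (u i) (u j) = (if i = j then 1 else 0)"
  by (simp add: onb_def)

lemma onb_complete:
  "onb n u \<Longrightarrow> a < n \<Longrightarrow> b < n \<Longrightarrow> (\<Sum>i<n. u i a * cnj (u i b)) = (if a = b then 1 else 0)"
  by (simp add: onb_def)

text \<open>Completeness is automatic, since a left inverse of a square matrix is a right inverse.\<close>

lemma onbI:
  assumes "\<And>i j. i < n \<Longrightarrow> j < n \<Longrightarrow> cip n (u i) (u j) = (if i = j then 1 else 0)"
  shows "onb n u"
proof -
  define U where "U = mat n n (\<lambda>(a, i). u i a)"
  have U: "U \<in> carrier_mat n n" by (simp add: U_def)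
  have "mat_adjoint U * U = 1\<^sub>m n"
  proof (rule eq_matI)
    fix i j assume "i < dim_row (1\<^sub>m n)" "j < dim_col (1\<^sub>m n)"
    then have ij: "i < n" "j < n" by auto
    have "(mat_adjoint U * U) $$ (i, j) = cip n (u j) (u i)"
      using ij U by (subst mat_mult_index[of _ n n _ n])
        (auto simp: U_def cip_def mult.commute intro!: sum.cong)
    then show "(mat_adjoint U * U) $$ (i, j) = 1\<^sub>m n $$ (i, j)"
      using assms[OF ij(2,1)] ij by auto
  qed (use U in auto)
  then have *: "U * mat_adjoint U = 1\<^sub>m n"
    using mat_mult_left_right_inverse[OF mat_adjoint_carrier[OF U] U] by simp
  have "(\<Sum>i<n. u i a * cnj (u i b)) = (if a = b then 1 else 0)" if ab: "a < n" "b < n" for a b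
  proof -
    have "(U * mat_adjoint U) $$ (a, b) = (\<Sum>i<n. u i a * cnj (u i b))"
      using ab U by (subst mat_mult_index[of _ n n _ n]) (auto simp: U_def intro!: sum.cong)
    then show ?thesis using * ab by simp
  qed
  then show ?thesis using assms by (auto simp: onb_def)
qed

lemma onb_expand:
  assumes "onb n u" "a < n"
  shows "(\<Sum>i<n. cip n x (u i) * u i a) = x a"
proof -
  have "(\<Sum>i<n. cip n x (u i) * u i a) = (\<Sum>b<n. \<Sum>i<n. x b * (u i a * cnj (u i b)))"
    by (subst sum.swap) (simp add: cip_def sum_distrib_left sum_distrib_right mult_ac)
  also have "\<dots> = (\<Sum>b<n. x b * (if a = b then 1 else 0))"
    using assms by (intro sum.cong) (auto simp: sum_distrib_left[symmetric] onb_complete)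
  finally show ?thesis using assms(2) by (simp add: sum_delta_lessThan)
qed

lemma cip_sum_left: "cip n (\<lambda>a. \<Sum>i\<in>I. c i * x i a) y = (\<Sum>i\<in>I. c i * cip n (x i) y)"
  by (simp add: cip_def sum_distrib_left sum_distrib_right mult.assoc) (rule sum.swap)

lemma cip_sum_right: "cip n y (\<lambda>a. \<Sum>i\<in>I. c i * x i a) = (\<Sum>i\<in>I. cnj (c i) * cip n y (x i))"
  by (subst cnj_cip[symmetric], subst cip_sum_left) (simp add: cnj_cip)

lemma cip_cong: "(\<And>a. a < n \<Longrightarrow> x a = x' a) \<Longrightarrow> (\<And>a. a < n \<Longrightarrow> y a = y' a) \<Longrightarrow> cip n x y = cip n x' y'"
  unfolding cip_def by (intro sum.cong) auto

lemma cip_scale: "cip n (\<lambda>a. c * x a) (\<lambda>a. d * y a) = c * cnj d * cip n x y"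
  by (simp add: cip_def sum_distrib_left mult_ac)

lemma parseval:
  assumes "onb n u"
  shows "(\<Sum>i<n. cip n x (u i) * cnj (cip n y (u i))) = cip n x y"
proof -
  have "cip n x y = cip n (\<lambda>a. \<Sum>i<n. cip n x (u i) * u i a) y"
    using onb_expand[OF assms, of _ x] by (intro cip_cong) auto
  then show ?thesis by (simp add: cip_sum_left cnj_cip)
qed

text \<open>Gram-Schmidt yields orthogonal nonzero vectors that start with \<open>v\<close> itself
  but are not normalized. Dividing by the norms keeps the first direction, and the factor
  \<open>c\<close> records the rescaling of \<open>v\<close>.\<close>

lemma extend_to_onb:
  assumes v: "v \<in> carrier_vec n" "v \<noteq> 0\<^sub>v n"
  obtains u c where "onb n u" "c \<noteq> 0" "\<And>a. a < n \<Longrightarrow> u 0 a = c * v $ a"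
proof -
  interpret cof_vec_space n "TYPE(complex)" .
  define b where "b = basis_completion v"
  define ws where "ws = gram_schmidt n b"
  from basis_completion[OF v, folded b_def]
  have dist_b: "distinct b" and indep: "\<not> lin_dep (set b)" and b: "set b \<subseteq> carrier_vec n"
    and hdb: "hd b = v" and len_b: "length b = n" by auto
  have n: "n \<noteq> 0" using v by auto
  from hdb len_b n obtain vs where bv: "b = v # vs" by (cases b, auto)
  from gram_schmidt_result[OF b dist_b indep refl, folded ws_def]
  have ws: "set ws \<subseteq> carrier_vec n" "corthogonal ws" "length ws = n"
    by (auto simp: len_b)
  from gram_schmidt_hd[OF v(1), of vs, folded bv] have hdws: "hd ws = v" unfolding ws_def .
  then have ws0: "ws ! 0 = v" using ws(3) n by (cases ws) auto
  define w where "w i a = ws ! i $ a" for i a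
  have wc: "ws ! i \<in> carrier_vec n" if "i < n" for i using ws that by auto
  have cw: "cip n (w i) (w j) = ws ! i \<bullet>c ws ! j" if "i < n" "j < n" for i j
    using wc[OF that(1)] wc[OF that(2)]
    by (auto simp: cip_def w_def scalar_prod_def lessThan_atLeast0 intro!: sum.cong)
  have orth: "cip n (w i) (w j) = 0 \<longleftrightarrow> i \<noteq> j" if "i < n" "j < n" for i j
    using corthogonalD[OF ws(2)] ws(3) that cw by auto
  define s where "s i = sqrt (\<Sum>a<n. (cmod (w i a))\<^sup>2)" for i
  have s2: "cip n (w i) (w i) = complex_of_real (s i) * complex_of_real (s i)" for i
    unfolding cip_self s_def of_real_mult[symmetric]
    by (subst real_sqrt_mult_self) (simp add: sum_nonneg)
  have s0: "s i \<noteq> 0" if "i < n" for i using orth[OF that that] s2[of i] by auto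
  define u where "u i a = complex_of_real (1 / s i) * w i a" for i a
  have "onb n u"
  proof (rule onbI)
    fix i j assume "i < n" "j < n"
    then show "cip n (u i) (u j) = (if i = j then 1 else 0)"
      unfolding u_def cip_scale using orth[of i j] s0 by (auto simp: s2)
  qed
  moreover have "complex_of_real (1 / s 0) \<noteq> 0" using s0[of 0] n by auto
  moreover have "u 0 a = complex_of_real (1 / s 0) * v $ a" if "a < n" for a
    by (simp add: u_def w_def ws0)
  ultimately show ?thesis using that by blast
qed

section \<open>Diagonalization of Hermitian forms by deflation\<close>

definition hermitian_form :: "nat \<Rightarrow> (nat \<Rightarrow> nat \<Rightarrow> complex) \<Rightarrow> bool" where
  "hermitian_form n X \<longleftrightarrow> (\<forall>a<n. \<forall>b<n. cnj (X a b) = X b a)"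

lemma sum_lessThan_Suc_shift_0: "(\<Sum>i<Suc n. f i) = f 0 + (\<Sum>i<n. f (Suc i))"
  for f :: "nat \<Rightarrow> complex"
  by (rule sum.lessThan_Suc_shift)

text \<open>Deflation. In a basis \<open>u\<close> whose first vector is an eigenvector, the matrix
  \<open>Y\<close> of \<open>X\<close> has first column \<open>e\<close>, 0, ..., 0 and, being
  Hermitian, the same first row; in particular \<open>e\<close> is real. The induction hypothesis
  applies to the block of the remaining indices.\<close>

lemma spectral_eigenvectors:
  "hermitian_form n X \<Longrightarrow>
    \<exists>u d. onb n u \<and> (\<forall>i<n. \<forall>a<n. (\<Sum>b<n. X a b * u i b) = complex_of_real (d i) * u i a)"
proof (induction n arbitrary: X)
  case 0
  then show ?case by (auto simp: onb_def)
next
  case (Suc n)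
  let ?N = "Suc n"
  have herm: "X b a = cnj (X a b)" if "a < ?N" "b < ?N" for a b
    using Suc.prems that unfolding hermitian_form_def by metis
  define A where "A = mat ?N ?N (\<lambda>(a, b). X a b)"
  have A: "A \<in> carrier_mat ?N ?N" by (simp add: A_def)
  obtain e where "eigenvalue A e"
    using spectrum_non_empty[OF A] by (auto simp: spectrum_def)
  then obtain v where v: "v \<in> carrier_vec ?N" "v \<noteq> 0\<^sub>v ?N" "A *\<^sub>v v = e \<cdot>\<^sub>v v"
    using A unfolding eigenvalue_def eigenvector_def by auto
  have Xv: "(\<Sum>b<?N. X a b * v $ b) = e * v $ a" if "a < ?N" for a
  proof -
    have "(A *\<^sub>v v) $ a = (\<Sum>b<?N. X a b * v $ b)"
      using that v(1) by (auto simp: A_def scalar_prod_def lessThan_atLeast0 intro!: sum.cong)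
    then show ?thesis using v that by auto
  qed
  obtain u c where u: "onb ?N u" and c: "c \<noteq> 0" and u0: "\<And>a. a < ?N \<Longrightarrow> u 0 a = c * v $ a"
    using extend_to_onb[OF v(1,2)] by metis
  have Xu0: "(\<Sum>b<?N. X a b * u 0 b) = e * u 0 a" if "a < ?N" for a
  proof -
    have "(\<Sum>b<?N. X a b * u 0 b) = c * (\<Sum>b<?N. X a b * v $ b)"
      unfolding sum_distrib_left by (rule sum.cong[OF refl]) (simp add: u0)
    then show ?thesis using Xv[OF that] u0[OF that] by (simp add: mult_ac)
  qed
  define XX where "XX i a = (\<Sum>b<?N. X a b * u i b)" for i a
  define Y where "Y i j = cip ?N (XX j) (u i)" for i j
  have Yherm: "Y j i = cnj (Y i j)" for i j
  proof -
    have "cnj (Y i j) = (\<Sum>a<?N. \<Sum>b<?N. cnj (X a b) * cnj (u j b) * u i a)"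
      by (simp only: Y_def cip_def XX_def cnj_sum complex_cnj_mult complex_cnj_cnj sum_distrib_right)
    also have "\<dots> = (\<Sum>a<?N. \<Sum>b<?N. X b a * cnj (u j b) * u i a)"
      by (intro sum.cong refl) (simp only: herm[symmetric] lessThan_iff)
    also have "\<dots> = (\<Sum>b<?N. \<Sum>a<?N. X b a * cnj (u j b) * u i a)" by (rule sum.swap)
    also have "\<dots> = Y j i"
      unfolding Y_def cip_def XX_def sum_distrib_right by (simp only: mult_ac)
    finally show ?thesis by simp
  qed
  have Y0: "Y i 0 = (if i = 0 then e else 0)" if "i < ?N" for i
  proof -
    have "Y i 0 = cip ?N (\<lambda>a. e * u 0 a) (\<lambda>a. 1 * u i a)"
      unfolding Y_def by (rule cip_cong) (simp_all only: XX_def Xu0 mult_1)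
    then show ?thesis using that onb_orthonormal[OF u, of 0 i] unfolding cip_scale by simp
  qed
  have e_real: "e = complex_of_real (Re e)"
    using Yherm[of 0 0] Y0[of 0] by (simp add: complex_eq_iff)
  have "hermitian_form n (\<lambda>i j. Y (Suc i) (Suc j))"
    unfolding hermitian_form_def using Yherm by metis
  from Suc.IH[OF this] obtain w d where w: "onb n w" and
    d: "\<And>i a. i < n \<Longrightarrow> a < n \<Longrightarrow> (\<Sum>b<n. Y (Suc a) (Suc b) * w i b) = complex_of_real (d i) * w i a"
    by metis
  \<comment> \<open>Eigenvectors of the block, given by coordinates with respect to
    \<open>u 1\<close>, \<open>u 2\<close>, ..., are carried back to the original coordinates, with
    \<open>u 0\<close> put in front.\<close>
  define z where "z i = (case i of 0 \<Rightarrow> u 0 | Suc j \<Rightarrow> (\<lambda>a. \<Sum>k<n. w j k * u (Suc k) a))" for i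
  define dd where "dd i = (case i of 0 \<Rightarrow> Re e | Suc j \<Rightarrow> d j)" for i
  have z0: "z 0 = u 0" and zS: "z (Suc j) = (\<lambda>a. \<Sum>k<n. w j k * u (Suc k) a)" for j
    by (simp_all add: z_def)
  have "onb ?N z"
  proof (rule onbI)
    fix i j assume ij: "i < ?N" "j < ?N"
    have 1: "cip ?N (z (Suc i')) (u k) = (case k of 0 \<Rightarrow> 0 | Suc k' \<Rightarrow> w i' k')"
      if "k < ?N" for i' k
    proof -
      have "cip ?N (z (Suc i')) (u k) = (\<Sum>l<n. w i' l * (if Suc l = k then 1 else 0))"
        unfolding zS cip_sum_left by (intro sum.cong refl) (use that u onb_orthonormal in auto)
      then show ?thesis using that by (cases k) (auto simp: sum_delta_lessThan)
    qed
    show "cip ?N (z i) (z j) = (if i = j then 1 else 0)"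
    proof (cases i)
      case 0
      show ?thesis
      proof (cases j)
        case (Suc j')
        have "cip ?N (z j) (z i) = 0" using 1[of 0 j'] Suc 0 by (simp add: z0)
        then show ?thesis using cnj_cip[of ?N "z j" "z i"] 0 Suc by simp
      qed (use 0 onb_orthonormal[OF u] in \<open>simp add: z0\<close>)
    next
      case (Suc i')
      show ?thesis
      proof (cases j)
        case 0
        then show ?thesis using 1[of 0 i'] Suc by (simp add: z0)
      next
        case (Suc j')
        have "cip ?N (z i) (z j) = (\<Sum>k<n. cnj (w j' k) * w i' k)"
          unfolding Suc \<open>i = Suc i'\<close> zS[of j'] cip_sum_right
          by (intro sum.cong refl) (simp add: 1)
        then show ?thesis
          using onb_orthonormal[OF w, of i' j'] ij Suc \<open>i = Suc i'\<close> by (simp add: cip_def mult.commute)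
      qed
    qed
  qed
  moreover have "(\<Sum>b<?N. X a b * z i b) = complex_of_real (dd i) * z i a"
    if ia: "i < ?N" "a < ?N" for i a
  proof (cases i)
    case 0
    then show ?thesis using Xu0[OF ia(2)] e_real by (simp add: z0 dd_def)
  next
    case (Suc j)
    have "(\<Sum>b<?N. X a b * z i b) = (\<Sum>b<?N. \<Sum>k<n. w j k * (X a b * u (Suc k) b))"
      unfolding Suc zS by (simp only: sum_distrib_left mult_ac)
    also have "\<dots> = (\<Sum>k<n. w j k * XX (Suc k) a)"
      unfolding XX_def sum_distrib_left by (rule sum.swap)
    also have "\<dots> = (\<Sum>k<n. w j k * (\<Sum>l<?N. Y l (Suc k) * u l a))"
      using onb_expand[OF u ia(2)] by (simp only: Y_def)
    also have "\<dots> = (\<Sum>k<n. w j k * (\<Sum>l<n. Y (Suc l) (Suc k) * u (Suc l) a))"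
    proof (intro sum.cong refl)
      fix k assume "k \<in> {..<n}"
      then have "Y 0 (Suc k) = 0" using Yherm[of "Suc k" 0] Y0[of "Suc k"] by simp
      then show "w j k * (\<Sum>l<?N. Y l (Suc k) * u l a) = w j k * (\<Sum>l<n. Y (Suc l) (Suc k) * u (Suc l) a)"
        unfolding sum_lessThan_Suc_shift_0 by simp
    qed
    also have "\<dots> = (\<Sum>l<n. (\<Sum>k<n. Y (Suc l) (Suc k) * w j k) * u (Suc l) a)"
      unfolding sum_distrib_left sum_distrib_right by (subst sum.swap) (simp only: mult_ac)
    also have "\<dots> = (\<Sum>l<n. complex_of_real (d j) * w j l * u (Suc l) a)"
      by (intro sum.cong refl) (use d ia Suc in auto)
    also have "\<dots> = complex_of_real (dd i) * z i a"
      unfolding Suc zS dd_def by (simp add: sum_distrib_left mult_ac)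
    finally show ?thesis .
  qed
  ultimately show ?case by blast
qed

definition eigensystem ::
    "nat \<Rightarrow> (nat \<Rightarrow> nat \<Rightarrow> complex) \<Rightarrow> (nat \<Rightarrow> nat \<Rightarrow> complex) \<Rightarrow> (nat \<Rightarrow> real) \<Rightarrow> bool" where
  "eigensystem n X u d \<longleftrightarrow> onb n u \<and>
     (\<forall>a<n. \<forall>b<n. X a b = (\<Sum>i<n. complex_of_real (d i) * u i a * cnj (u i b)))"

lemma eigensystem_onb: "eigensystem n X u d \<Longrightarrow> onb n u"
  by (simp add: eigensystem_def)

lemma eigensystem_eq:
  "eigensystem n X u d \<Longrightarrow> a < n \<Longrightarrow> b < n \<Longrightarrow>
    X a b = (\<Sum>i<n. complex_of_real (d i) * u i a * cnj (u i b))"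
  by (simp add: eigensystem_def)

lemma spectral_theorem:
  assumes "hermitian_form n X"
  obtains u d where "eigensystem n X u d"
proof -
  obtain u d where u: "onb n u" and
    d: "\<And>i a. i < n \<Longrightarrow> a < n \<Longrightarrow> (\<Sum>b<n. X a b * u i b) = complex_of_real (d i) * u i a"
    using spectral_eigenvectors[OF assms] by metis
  have "X a b = (\<Sum>i<n. complex_of_real (d i) * u i a * cnj (u i b))" if ab: "a < n" "b < n" for a b
  proof -
    have "(\<Sum>i<n. complex_of_real (d i) * u i a * cnj (u i b)) =
      (\<Sum>i<n. (\<Sum>c<n. X a c * u i c) * cnj (u i b))"
      by (intro sum.cong refl) (use d ab in auto)
    also have "\<dots> = (\<Sum>c<n. X a c * (\<Sum>i<n. u i c * cnj (u i b)))"
      unfolding sum_distrib_left sum_distrib_right by (subst sum.swap) (simp only: mult_ac)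
    also have "\<dots> = (\<Sum>c<n. X a c * (if c = b then 1 else 0))"
      by (intro sum.cong refl) (use u ab onb_complete in auto)
    also have "\<dots> = X a b" using ab by (simp only: sum_delta_lessThan)
    finally show ?thesis by simp
  qed
  then have "eigensystem n X u d" using u by (simp add: eigensystem_def)
  then show ?thesis by (rule that)
qed

section \<open>Entropy\<close>

definition eta :: "real \<Rightarrow> real" where
  "eta x = - x * log 2 x"

lemma eta_nonneg: "0 \<le> x \<Longrightarrow> x \<le> 1 \<Longrightarrow> 0 \<le> eta x"
  by (cases "x = 0") (auto simp: eta_def mult_le_0_iff)

lemma eta_mult: "0 \<le> x \<Longrightarrow> 0 \<le> y \<Longrightarrow> eta (x * y) = y * eta x + x * eta y"
  by (cases "x = 0 \<or> y = 0") (auto simp: eta_def log_mult algebra_simps)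

lemma hermitian_form_mat:
  assumes "X \<in> carrier_mat n n"
  shows "hermitian_form n (\<lambda>a b. X $$ (a, b)) \<longleftrightarrow> mat_adjoint X = X"
proof
  assume h: "hermitian_form n (\<lambda>a b. X $$ (a, b))"
  show "mat_adjoint X = X"
    by (rule eq_matI) (use assms h in \<open>auto simp: hermitian_form_def\<close>)
next
  assume "mat_adjoint X = X"
  then have "cnj (X $$ (a, b)) = X $$ (b, a)" if "a < n" "b < n" for a b
    using mat_adjoint_index[of b X a] assms that by auto
  then show "hermitian_form n (\<lambda>a b. X $$ (a, b))"
    unfolding hermitian_form_def by metis
qed

lemma diagonalization_index:
  assumes "U \<in> carrier_mat n n" "a < n" "b < n"
  shows "(U * mat_diag n f * mat_adjoint U) $$ (a, b) = (\<Sum>i<n. f i * U $$ (a, i) * cnj (U $$ (b, i)))"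
proof -
  have "(U * mat_diag n f * mat_adjoint U) $$ (a, b) =
    (\<Sum>i<n. (U * mat_diag n f) $$ (a, i) * mat_adjoint U $$ (i, b))"
    using assms mult_carrier_mat[OF assms(1) mat_diag_dim, of f]
    by (intro mat_mult_index[of _ n n _ n]) auto
  also have "\<dots> = (\<Sum>i<n. f i * U $$ (a, i) * cnj (U $$ (b, i)))"
    using assms by (intro sum.cong refl) (simp add: mat_diag_mult_right[OF assms(1)])
  finally show ?thesis .
qed

lemma one_mat_iff:
  assumes "A \<in> carrier_mat n n"
  shows "A = 1\<^sub>m n \<longleftrightarrow> (\<forall>i<n. \<forall>j<n. A $$ (i, j) = (if i = j then 1 else 0))"
  using assms by (auto intro!: eq_matI)

lemma unitary_mat_iff_onb:
  assumes U: "U \<in> carrier_mat n n"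
  shows "unitary_mat n U \<longleftrightarrow> onb n (\<lambda>i a. U $$ (a, i))"
proof -
  have 1: "(mat_adjoint U * U) $$ (i, j) = cip n (\<lambda>a. U $$ (a, j)) (\<lambda>a. U $$ (a, i))"
    if "i < n" "j < n" for i j
    using that U by (subst mat_mult_index[of _ n n _ n]) (auto simp: cip_def mult.commute intro!: sum.cong)
  have 2: "(U * mat_adjoint U) $$ (a, b) = (\<Sum>i<n. U $$ (a, i) * cnj (U $$ (b, i)))"
    if "a < n" "b < n" for a b
    using that U by (subst mat_mult_index[of _ n n _ n]) (auto intro!: sum.cong)
  have 3: "mat_adjoint U * U = 1\<^sub>m n \<longleftrightarrow>
    (\<forall>i<n. \<forall>j<n. (mat_adjoint U * U) $$ (i, j) = (if i = j then 1 else 0))"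
    by (rule one_mat_iff) (use U in auto)
  have 4: "U * mat_adjoint U = 1\<^sub>m n \<longleftrightarrow>
    (\<forall>i<n. \<forall>j<n. (U * mat_adjoint U) $$ (i, j) = (if i = j then 1 else 0))"
    by (rule one_mat_iff) (use U in auto)
  show ?thesis unfolding unitary_mat_def onb_def 3 4 using U 1 2 by (auto simp del: index_mult_mat)
qed

text \<open>Since \<open>mat_fun\<close> is a Hilbert choice, all that is known of its value is that
  some diagonalization \<open>V\<close>, \<open>e\<close> produces it. Hence an unspecified
  eigensystem is exported; that other decompositions give the same value is the business of
  \<open>entropy_orthogonal_sum\<close>.\<close>

lemma entropy_spectral:
  assumes X: "X \<in> carrier_mat n n" and herm: "hermitian_form n (\<lambda>a b. X $$ (a, b))"
  obtains u d where "eigensystem n (\<lambda>a b. X $$ (a, b)) u d" "entropy X = (\<Sum>i<n. eta (d i))"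
proof -
  let ?P = "\<lambda>U d Y. unitary_mat (dim_row X) U \<and>
    X = U * mat_diag (dim_row X) (\<lambda>i. complex_of_real (d i)) * mat_adjoint U \<and>
    Y = U * mat_diag (dim_row X) (\<lambda>i. complex_of_real (log 2 (d i))) * mat_adjoint U"
  obtain u d where es: "eigensystem n (\<lambda>a b. X $$ (a, b)) u d"
    by (rule spectral_theorem[OF herm])
  note u = eigensystem_onb[OF es] and d = eigensystem_eq[OF es]
  define U where "U = mat n n (\<lambda>(a, i). u i a)"
  have U: "U \<in> carrier_mat n n" by (simp add: U_def)
  have "unitary_mat n U"
    unfolding unitary_mat_iff_onb[OF U] using u by (simp add: onb_def cip_def U_def)
  moreover have "X = U * mat_diag n (\<lambda>i. complex_of_real (d i)) * mat_adjoint U"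
  proof (rule eq_matI)
    fix a b assume "a < dim_row (U * mat_diag n (\<lambda>i. complex_of_real (d i)) * mat_adjoint U)"
      "b < dim_col (U * mat_diag n (\<lambda>i. complex_of_real (d i)) * mat_adjoint U)"
    then have "a < n" "b < n" using U by auto
    then show "X $$ (a, b) = (U * mat_diag n (\<lambda>i. complex_of_real (d i)) * mat_adjoint U) $$ (a, b)"
      unfolding diagonalization_index[OF U \<open>a < n\<close> \<open>b < n\<close>] by (simp add: d U_def)
  qed (use U X in auto)
  \<comment> \<open>The diagonalization built so far only shows that the choice ranges over a
    nonempty set; the rest of the proof works with the one actually chosen.\<close>
  ultimately have "?P U d (U * mat_diag n (\<lambda>i. complex_of_real (log 2 (d i))) * mat_adjoint U)"
    using X by auto
  then have "\<exists>Y U d. ?P U d Y" by blast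
  then have "\<exists>U d. ?P U d (mat_fun (log 2) X)"
    unfolding mat_fun_def by (rule someI_ex)
  then obtain V e where V: "unitary_mat n V"
    and X_eq: "X = V * mat_diag n (\<lambda>i. complex_of_real (e i)) * mat_adjoint V"
    and Y_eq: "mat_fun (log 2) X = V * mat_diag n (\<lambda>i. complex_of_real (log 2 (e i))) * mat_adjoint V"
    using X by auto
  have Vc: "V \<in> carrier_mat n n" and VV: "mat_adjoint V * V = 1\<^sub>m n"
    using V by (auto simp: unitary_mat_def)
  have onb: "onb n (\<lambda>i a. V $$ (a, i))" using V unitary_mat_iff_onb[OF Vc] by blast
  let ?D = "mat_diag n (\<lambda>i. complex_of_real (e i))"
  let ?L = "mat_diag n (\<lambda>i. complex_of_real (log 2 (e i)))"
  let ?A = "mat_adjoint V"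
  have A: "?A \<in> carrier_mat n n" using Vc by auto
  have "X * mat_fun (log 2) X = V * ?D * ?A * (V * ?L * ?A)" using X_eq Y_eq by simp
  also have "\<dots> = V * (?D * ?L) * ?A"
  proof -
    note assoc = assoc_mult_mat[of _ n n _ n _ n] mult_carrier_mat[of _ n n _ n]
    have "V * ?D * ?A * (V * ?L * ?A) = V * ?D * (?A * (V * (?L * ?A)))"
      using Vc A by (simp add: assoc)
    also have "?A * (V * (?L * ?A)) = ?A * V * (?L * ?A)"
      using Vc A by (simp add: assoc)
    also have "\<dots> = ?L * ?A" using VV left_mult_one_mat[OF mult_carrier_mat[OF mat_diag_dim A]] by simp
    finally show ?thesis using Vc A by (simp add: assoc del: mat_diag_diag)
  qed
  finally have prod: "X * mat_fun (log 2) X =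
    V * mat_diag n (\<lambda>i. complex_of_real (e i * log 2 (e i))) * ?A" by simp
  have "mat_trace (X * mat_fun (log 2) X) =
    (\<Sum>a<n. \<Sum>i<n. complex_of_real (e i * log 2 (e i)) * V $$ (a, i) * cnj (V $$ (a, i)))"
    unfolding mat_trace_def prod
    by (intro sum.cong) (use Vc diagonalization_index[OF Vc] in \<open>auto simp del: index_mult_mat(1)\<close>)
  also have "\<dots> = (\<Sum>i<n. complex_of_real (e i * log 2 (e i)) * cip n (\<lambda>a. V $$ (a, i)) (\<lambda>a. V $$ (a, i)))"
    unfolding cip_def sum_distrib_left by (subst sum.swap) (simp only: mult.assoc)
  also have "\<dots> = (\<Sum>i<n. complex_of_real (e i * log 2 (e i)))"
    by (intro sum.cong refl) (use onb_orthonormal[OF onb] in simp)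
  finally have "entropy X = (\<Sum>i<n. eta (e i))"
    unfolding entropy_def eta_def by (simp add: sum_negf)
  moreover have "X $$ (a, b) = (\<Sum>i<n. complex_of_real (e i) * V $$ (a, i) * cnj (V $$ (b, i)))"
    if "a < n" "b < n" for a b
    using diagonalization_index[OF Vc that] X_eq by metis
  ultimately show ?thesis
    using that[of "\<lambda>i a. V $$ (a, i)" e] onb by (simp add: eigensystem_def)
qed

lemma hermitian_form_orthogonal_sum:
  assumes "\<And>a b. a < n \<Longrightarrow> b < n \<Longrightarrow> X a b = (\<Sum>j\<in>J. y j a * cnj (y j b))"
  shows "hermitian_form n X"
  unfolding hermitian_form_def by (intro allI impI) (simp add: assms mult.commute)

text \<open>
  With \<open>W i j = cip n (y j) (u i)\<close> for an eigenbasis u of X, the square moduli \<open>\<bar>W i j\<bar>\<^sup>2\<close> have row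
  sums \<open>d i\<close> and column sums \<open>m j\<close>, and they vanish unless \<open>d i = m j\<close>.
\<close>

lemma entropy_orthogonal_sum:
  assumes X: "X \<in> carrier_mat n n"
    and X_eq: "\<And>a b. a < n \<Longrightarrow> b < n \<Longrightarrow> X $$ (a, b) = (\<Sum>j\<in>J. y j a * cnj (y j b))"
    and J: "finite J"
    and orth: "\<And>i j. i \<in> J \<Longrightarrow> j \<in> J \<Longrightarrow> cip n (y i) (y j) = (if i = j then complex_of_real (m j) else 0)"
  shows "entropy X = (\<Sum>j\<in>J. eta (m j))"
proof -
  obtain u d where es: "eigensystem n (\<lambda>a b. X $$ (a, b)) u d"
    and ent: "entropy X = (\<Sum>i<n. eta (d i))"
    by (rule entropy_spectral[OF X hermitian_form_orthogonal_sum[OF X_eq]])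
  note u = eigensystem_onb[OF es] and d = eigensystem_eq[OF es]
  define W where "W i j = cip n (y j) (u i)" for i j
  \<comment> \<open>\<open>F i\<close> is the row vector obtained by multiplying \<open>X\<close>
    from the left with the adjoint of \<open>u i\<close>. The eigenbasis and the vectors
    \<open>y\<close> each give it in closed form; comparing the two yields the relation
    \<open>eigen\<close> and the row sums of \<open>W\<close>.\<close>
  define F where "F i b = (\<Sum>a<n. cnj (u i a) * X $$ (a, b))" for i b
  have F_d: "F i b = complex_of_real (d i) * cnj (u i b)" if "i < n" "b < n" for i b
  proof -
    have "F i b = (\<Sum>a<n. \<Sum>k<n. complex_of_real (d k) * cnj (u k b) * (u k a * cnj (u i a)))"
      unfolding F_def by (intro sum.cong refl) (use that in \<open>simp add: d sum_distrib_left mult_ac\<close>)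
    also have "\<dots> = (\<Sum>k<n. complex_of_real (d k) * cnj (u k b) * cip n (u k) (u i))"
      unfolding cip_def sum_distrib_left by (rule sum.swap)
    also have "\<dots> = (\<Sum>k<n. complex_of_real (d k) * cnj (u k b) * (if k = i then 1 else 0))"
      by (intro sum.cong refl) (use onb_orthonormal[OF u] that in auto)
    also have "\<dots> = complex_of_real (d i) * cnj (u i b)" using that by (simp only: sum_delta_lessThan)
    finally show ?thesis .
  qed
  have F_y: "F i b = (\<Sum>j\<in>J. cnj (y j b) * W i j)" if "i < n" "b < n" for i b
  proof -
    have "F i b = (\<Sum>a<n. \<Sum>j\<in>J. cnj (y j b) * (y j a * cnj (u i a)))"
      unfolding F_def by (intro sum.cong refl) (use that in \<open>simp add: X_eq sum_distrib_left mult_ac\<close>)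
    then show ?thesis unfolding W_def cip_def sum_distrib_left by (subst sum.swap) simp
  qed
  have eigen: "complex_of_real (d i) * W i j = complex_of_real (m j) * W i j" if "i < n" "j \<in> J" for i j
  proof -
    have "complex_of_real (d i) * W i j = (\<Sum>b<n. F i b * y j b)"
      unfolding W_def cip_def sum_distrib_left by (intro sum.cong refl) (use that in \<open>simp add: F_d\<close>)
    also have "\<dots> = (\<Sum>b<n. \<Sum>k\<in>J. W i k * (y j b * cnj (y k b)))"
      by (intro sum.cong refl) (use that in \<open>simp add: F_y sum_distrib_left sum_distrib_right mult_ac\<close>)
    also have "\<dots> = (\<Sum>k\<in>J. W i k * cip n (y j) (y k))"
      unfolding cip_def sum_distrib_left by (rule sum.swap)
    also have "\<dots> = (\<Sum>k\<in>J. if k = j then W i k * complex_of_real (m k) else 0)"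
      by (intro sum.cong refl) (use orth that in auto)
    finally show ?thesis using that J by simp
  qed
  have row: "(\<Sum>j\<in>J. (cmod (W i j))\<^sup>2) = d i" if "i < n" for i
  proof -
    have "complex_of_real (\<Sum>j\<in>J. (cmod (W i j))\<^sup>2) = (\<Sum>j\<in>J. W i j * cnj (W i j))"
      by (simp add: complex_norm_square[symmetric])
    also have "\<dots> = (\<Sum>j\<in>J. \<Sum>b<n. (cnj (y j b) * W i j) * u i b)"
    proof (intro sum.cong refl)
      fix j
      have "cnj (W i j) = (\<Sum>b<n. u i b * cnj (y j b))"
        unfolding W_def cnj_cip by (rule cip_def)
      then show "W i j * cnj (W i j) = (\<Sum>b<n. (cnj (y j b) * W i j) * u i b)"
        by (simp add: sum_distrib_left mult_ac)
    qed
    also have "\<dots> = (\<Sum>b<n. (\<Sum>j\<in>J. cnj (y j b) * W i j) * u i b)"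
      unfolding sum_distrib_right by (rule sum.swap)
    also have "\<dots> = (\<Sum>b<n. complex_of_real (d i) * (u i b * cnj (u i b)))"
      by (intro sum.cong refl) (use that in \<open>simp add: F_y[symmetric] F_d\<close>)
    also have "\<dots> = complex_of_real (d i)"
      using onb_orthonormal[OF u that that] by (simp add: sum_distrib_left[symmetric] cip_def)
    finally show ?thesis using of_real_eq_iff by blast
  qed
  have col: "(\<Sum>i<n. (cmod (W i j))\<^sup>2) = m j" if "j \<in> J" for j
  proof -
    have "complex_of_real (\<Sum>i<n. (cmod (W i j))\<^sup>2) = (\<Sum>i<n. W i j * cnj (W i j))"
      by (simp add: complex_norm_square[symmetric])
    also have "\<dots> = complex_of_real (m j)"
      unfolding W_def parseval[OF u] using orth that by simp
    finally show ?thesis using of_real_eq_iff by blast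
  qed
  have "entropy X = (\<Sum>i<n. \<Sum>j\<in>J. (cmod (W i j))\<^sup>2 * (- log 2 (d i)))"
    unfolding ent eta_def sum_distrib_right[symmetric] by (intro sum.cong refl) (simp add: row)
  also have "\<dots> = (\<Sum>i<n. \<Sum>j\<in>J. (cmod (W i j))\<^sup>2 * (- log 2 (m j)))"
  proof (intro sum.cong refl)
    fix i j assume "i \<in> {..<n}" "j \<in> J"
    then have "W i j = 0 \<or> d i = m j" using eigen[of i j] by auto
    then show "(cmod (W i j))\<^sup>2 * (- log 2 (d i)) = (cmod (W i j))\<^sup>2 * (- log 2 (m j))" by auto
  qed
  also have "\<dots> = (\<Sum>j\<in>J. (\<Sum>i<n. (cmod (W i j))\<^sup>2) * (- log 2 (m j)))"
    unfolding sum_distrib_right by (rule sum.swap)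
  also have "\<dots> = (\<Sum>j\<in>J. eta (m j))"
    unfolding eta_def by (intro sum.cong refl) (simp add: col)
  finally show ?thesis .
qed

section \<open>Positive semidefinite matrices and Klein's inequality\<close>

lemma psd_mat_form:
  assumes "psd_mat n X"
  shows "0 \<le> Re (\<Sum>a<n. \<Sum>b<n. cnj (v a) * X $$ (a, b) * v b)"
proof -
  have X: "X \<in> carrier_mat n n" using assms by (simp add: psd_mat_def)
  have "(X *\<^sub>v vec n v) \<bullet>c vec n v = (\<Sum>a<n. \<Sum>b<n. cnj (v a) * X $$ (a, b) * v b)"
    using X by (auto simp: scalar_prod_def lessThan_atLeast0 sum_distrib_left sum_distrib_right mult_ac
        intro!: sum.cong)
  moreover have "0 \<le> Re ((X *\<^sub>v vec n v) \<bullet>c vec n v)"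
    using assms by (simp add: psd_mat_def)
  ultimately show ?thesis by simp
qed

lemma psd_matI:
  assumes X: "X \<in> carrier_mat n n" and "hermitian_form n (\<lambda>a b. X $$ (a, b))"
    and pos: "\<And>v. 0 \<le> Re (\<Sum>a<n. \<Sum>b<n. cnj (v a) * X $$ (a, b) * v b)"
  shows "psd_mat n X"
  unfolding psd_mat_def
proof (intro conjI ballI)
  show "mat_adjoint X = X" using assms(2) hermitian_form_mat[OF X] by simp
  fix v :: "complex vec" assume v: "v \<in> carrier_vec n"
  have "(X *\<^sub>v v) \<bullet>c v = (\<Sum>a<n. \<Sum>b<n. cnj (v $ a) * X $$ (a, b) * v $ b)"
    using X v by (auto simp: scalar_prod_def lessThan_atLeast0 sum_distrib_left sum_distrib_right mult_ac
        intro!: sum.cong)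
  then show "0 \<le> Re ((X *\<^sub>v v) \<bullet>c v)" using pos[of "\<lambda>a. v $ a"] by simp
qed (fact X)

lemma psd_mat_hermitian: "psd_mat n X \<Longrightarrow> hermitian_form n (\<lambda>a b. X $$ (a, b))"
  using hermitian_form_mat by (auto simp: psd_mat_def)

lemma onb_permute:
  assumes "onb n u" "bij_betw h {..<n} {..<n}"
  shows "onb n (\<lambda>i. u (h i))"
proof (rule onbI)
  fix i j assume ij: "i < n" "j < n"
  then have "h i < n" "h j < n" using assms(2) by (auto simp: bij_betw_def)
  moreover have "h i = h j \<longleftrightarrow> i = j" using assms(2) ij by (auto simp: bij_betw_def inj_on_def)
  ultimately show "cip n (u (h i)) (u (h j)) = (if i = j then 1 else 0)"
    using onb_orthonormal[OF assms(1)] by simp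
qed

text \<open>Allows the positive eigenvalues to be listed first, so that later sums run over an
  initial segment \<open>{..<r}\<close> on which logarithms and square roots have positive
  arguments.\<close>

lemma ex_enumeration_support_first:
  fixes P :: "nat \<Rightarrow> bool"
  obtains h r where "bij_betw h {..<n} {..<n}" "r \<le> n" "\<forall>i<n. P (h i) \<longleftrightarrow> i < r"
proof -
  let ?A = "{i. i < n \<and> P i}" and ?B = "{i. i < n \<and> \<not> P i}"
  define r where "r = card ?A"
  have r: "r \<le> n" unfolding r_def using card_mono[of "{..<n}" ?A] by auto
  have "card {..<r} = card ?A" by (simp add: r_def)
  then obtain f where f: "bij_betw f {..<r} ?A"
    using finite_same_card_bij[of "{..<r}" ?A] by auto
  have "card ?A + card ?B = card {..<n}"
    by (subst card_Un_disjoint[symmetric]) (auto intro!: arg_cong[where f = card, of _ "{..<n}", simplified])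
  then have "card {r..<n} = card ?B" by (simp add: r_def)
  then obtain g where g: "bij_betw g {r..<n} ?B"
    using finite_same_card_bij[of "{r..<n}" ?B] by auto
  define h where "h i = (if i < r then f i else g i)" for i
  have f': "bij_betw h {..<r} ?A" using f by (rule bij_betw_cong[THEN iffD1, rotated]) (auto simp: h_def)
  have g': "bij_betw h {r..<n} ?B" using g by (rule bij_betw_cong[THEN iffD1, rotated]) (auto simp: h_def)
  have "bij_betw h ({..<r} \<union> {r..<n}) (?A \<union> ?B)" using f' g' by (rule bij_betw_combine) auto
  moreover have "{..<r} \<union> {r..<n} = {..<n}" "?A \<union> ?B = {..<n}" using r by auto
  ultimately have "bij_betw h {..<n} {..<n}" by simp
  moreover have "P (h i) \<longleftrightarrow> i < r" if "i < n" for i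
  proof (cases "i < r")
    case True
    then have "h i \<in> ?A" using bij_betwE[OF f'] by blast
    then show ?thesis using True by auto
  next
    case False
    then have "h i \<in> ?B" using bij_betwE[OF g'] that by auto
    then show ?thesis using False by auto
  qed
  ultimately show ?thesis using r that by blast
qed

text \<open>\<open>r\<close> is the rank. The kernel vectors stay in the basis, since Parseval's
  identity and expansions need all \<open>n\<close> vectors, while logarithms and divisions are
  confined to indices below \<open>r\<close>.\<close>

definition psd_eigensystem ::
    "nat \<Rightarrow> (nat \<Rightarrow> nat \<Rightarrow> complex) \<Rightarrow> (nat \<Rightarrow> nat \<Rightarrow> complex) \<Rightarrow> (nat \<Rightarrow> real) \<Rightarrow> nat \<Rightarrow> bool" where
  "psd_eigensystem n X u d r \<longleftrightarrow> eigensystem n X u d \<and> r \<le> n \<and> (\<forall>i<r. 0 < d i) \<and>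
     (\<forall>i<n. r \<le> i \<longrightarrow> d i = 0)"

lemma psd_eigensystem_eq:
  assumes "psd_eigensystem n X u d r" "a < n" "b < n"
  shows "X a b = (\<Sum>i<r. complex_of_real (d i) * u i a * cnj (u i b))"
proof -
  have "X a b = (\<Sum>i<n. complex_of_real (d i) * u i a * cnj (u i b))"
    using assms by (simp add: psd_eigensystem_def eigensystem_eq)
  also have "\<dots> = (\<Sum>i<r. complex_of_real (d i) * u i a * cnj (u i b))"
    by (rule sum.mono_neutral_right) (use assms(1) in \<open>auto simp: psd_eigensystem_def\<close>)
  finally show ?thesis .
qed

lemma psd_spectral:
  assumes "psd_mat n X"
  obtains u d r where "psd_eigensystem n (\<lambda>a b. X $$ (a, b)) u d r"
proof -
  obtain u d where es: "eigensystem n (\<lambda>a b. X $$ (a, b)) u d"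
    by (rule spectral_theorem[OF psd_mat_hermitian[OF assms]])
  note u = eigensystem_onb[OF es] and d = eigensystem_eq[OF es]
  have d0: "0 \<le> d i" if i: "i < n" for i
  proof -
    have "(\<Sum>a<n. \<Sum>b<n. cnj (u i a) * X $$ (a, b) * u i b) =
      (\<Sum>a<n. \<Sum>b<n. \<Sum>k<n. complex_of_real (d k) * ((u k a * cnj (u i a)) * (u i b * cnj (u k b))))"
      by (intro sum.cong refl) (simp add: d sum_distrib_left sum_distrib_right mult_ac)
    also have "\<dots> = (\<Sum>k<n. \<Sum>a<n. \<Sum>b<n. complex_of_real (d k) * ((u k a * cnj (u i a)) * (u i b * cnj (u k b))))"
      by (rule sum_rotate)
    also have "\<dots> = (\<Sum>k<n. complex_of_real (d k) * (cip n (u k) (u i) * cip n (u i) (u k)))"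
      unfolding cip_def sum_product by (simp only: sum_distrib_left)
    also have "\<dots> = (\<Sum>k<n. complex_of_real (d k) * (if k = i then 1 else 0))"
      by (intro sum.cong refl) (use onb_orthonormal[OF u] i in auto)
    also have "\<dots> = complex_of_real (d i)" using i by (simp only: sum_delta_lessThan)
    finally show ?thesis using psd_mat_form[OF assms, of "u i"] by simp
  qed
  obtain h r where h: "bij_betw h {..<n} {..<n}" "r \<le> n" "\<forall>i<n. 0 < d (h i) \<longleftrightarrow> i < r"
    by (rule ex_enumeration_support_first[of n "\<lambda>i. 0 < d i"])
  have hn: "h i < n" if "i < n" for i using h(1) that by (auto simp: bij_betw_def)
  have z: "d (h i) = 0" if "i < n" "r \<le> i" for i using d0[OF hn[OF that(1)]] h(3) that by auto
  have p: "0 < d (h i)" if "i < r" for i using h(2,3) that by auto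
  have e1: "X $$ (a, b) = (\<Sum>i<n. complex_of_real (d (h i)) * u (h i) a * cnj (u (h i) b))"
    if "a < n" "b < n" for a b
    unfolding d[OF that]
    using sum.reindex_bij_betw[OF h(1), of "\<lambda>i. complex_of_real (d i) * u i a * cnj (u i b)"] by simp
  have "eigensystem n (\<lambda>a b. X $$ (a, b)) (\<lambda>i. u (h i)) (\<lambda>i. d (h i))"
    unfolding eigensystem_def using onb_permute[OF u h(1)] e1 by blast
  then have "psd_eigensystem n (\<lambda>a b. X $$ (a, b)) (\<lambda>i. u (h i)) (\<lambda>i. d (h i)) r"
    using h(2) z p by (simp add: psd_eigensystem_def)
  then show ?thesis by (rule that)
qed

text \<open>The tangent bound \<open>ln t \<le> t - 1\<close> at \<open>t = l / m\<close>,
  multiplied by \<open>m\<close>, with equality only at \<open>t = 1\<close>; dividing by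
  \<open>ln 2\<close> passes to base 2. For \<open>m = 0\<close> the inequality is strict because
  \<open>l\<close> is positive. The linear left-hand side is kept because it cancels once both
  families sum to one.\<close>

lemma relative_entropy_summand:
  assumes "0 \<le> m" "0 < (l::real)"
  shows "(m - l) / ln 2 \<le> m * log 2 m - m * log 2 l"
    and "(m - l) / ln 2 = m * log 2 m - m * log 2 l \<Longrightarrow> m = l"
proof -
  have eq: "m * log 2 m - m * log 2 l - (m - l) / ln 2 = m * ((l / m - 1) - ln (l / m)) / ln 2"
    if "0 < m"
    using that assms(2) by (simp add: log_def ln_div field_simps)
  have le: "ln (l / m) \<le> l / m - 1" if "0 < m"
    using that assms(2) by (intro ln_le_minus_one) simp
  show "(m - l) / ln 2 \<le> m * log 2 m - m * log 2 l"
  proof (cases "m = 0")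
    case False
    then have "0 < m" using assms by simp
    then have "0 \<le> m * ((l / m - 1) - ln (l / m)) / ln 2" using le by (intro divide_nonneg_nonneg mult_nonneg_nonneg) auto
    then show ?thesis using eq[OF \<open>0 < m\<close>] by linarith
  qed (use assms in auto)
  show "m = l" if h: "(m - l) / ln 2 = m * log 2 m - m * log 2 l"
  proof (cases "m = 0")
    case False
    then have m: "0 < m" using assms by simp
    then have "m * ((l / m - 1) - ln (l / m)) / ln 2 = 0" using eq[OF m] h by linarith
    then have "ln (l / m) = l / m - 1" using m by auto
    then have "l / m = 1" using m assms(2) by (intro ln_eq_minus_one) auto
    then show ?thesis using m by simp
  qed (use h assms in auto)
qed

text \<open>
  If G is the Gram matrix of the vectors x, then X and G have the same nonzero eigenvalues, and the
  inequality is Klein's inequality for G and the diagonal matrix of l.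
\<close>

lemma gram_entropy:
  fixes x :: "nat \<Rightarrow> nat \<Rightarrow> complex" and l :: "nat \<Rightarrow> real"
  assumes X: "X \<in> carrier_mat n n"
    and X_eq: "\<And>a b. a < n \<Longrightarrow> b < n \<Longrightarrow> X $$ (a, b) = (\<Sum>k<r. x k a * cnj (x k b))"
    and tr: "(\<Sum>k<r. Re (cip n (x k) (x k))) = 1"
    and l_pos: "\<And>k. k < r \<Longrightarrow> 0 < l k" and l_sum: "(\<Sum>k<r. l k) = 1"
  shows "entropy X \<le> (\<Sum>k<r. Re (cip n (x k) (x k)) * (- log 2 (l k)))" (is ?le)
    and "entropy X = (\<Sum>k<r. Re (cip n (x k) (x k)) * (- log 2 (l k))) \<Longrightarrow> i < r \<Longrightarrow> j < r \<Longrightarrow>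
      cip n (x i) (x j) = (if i = j then complex_of_real (l i) else 0)" (is "?eq \<Longrightarrow> _ \<Longrightarrow> _ \<Longrightarrow> _")
proof -
  define G where "G i j = cip n (x j) (x i)" for i j
  have "hermitian_form r G" by (simp add: hermitian_form_def G_def cnj_cip)
  then obtain u m where es: "eigensystem r G u m" by (rule spectral_theorem)
  note u = eigensystem_onb[OF es] and G_eq = eigensystem_eq[OF es]
  \<comment> \<open>Unitary freedom of ensembles: mixing the vectors \<open>x i\<close> with an
    eigenbasis of their Gram matrix preserves the sum \<open>X\<close> and makes them orthogonal,
    with squared norms the eigenvalues \<open>m k\<close>.\<close>
  define y where "y k a = (\<Sum>i<r. u k i * x i a)" for k a
  have y_orth: "cip n (y i) (y j) = (if i = j then complex_of_real (m j) else 0)"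
    if ij: "i \<in> {..<r}" "j \<in> {..<r}" for i j
  proof -
    have "cip n (y i) (y j) = (\<Sum>p<r. u i p * (\<Sum>q<r. cnj (u j q) * G q p))"
      unfolding y_def cip_sum_left cip_sum_right G_def by (rule refl)
    also have "\<dots> = (\<Sum>p<r. \<Sum>q<r. \<Sum>k<r. complex_of_real (m k) * ((u k q * cnj (u j q)) * (u i p * cnj (u k p))))"
      unfolding sum_distrib_left
      by (intro sum.cong refl) (simp add: G_eq sum_distrib_left mult_ac)
    also have "\<dots> = (\<Sum>k<r. \<Sum>p<r. \<Sum>q<r. complex_of_real (m k) * ((u k q * cnj (u j q)) * (u i p * cnj (u k p))))"
      by (rule sum_rotate)
    also have "\<dots> = (\<Sum>k<r. complex_of_real (m k) * (cip r (u k) (u j) * cip r (u i) (u k)))"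
      unfolding cip_def sum_product by (subst (2) sum.swap) (simp only: sum_distrib_left)
    also have "\<dots> = (\<Sum>k<r. complex_of_real (m k) * (if i = j then 1 else 0) * (if k = j then 1 else 0))"
      by (intro sum.cong refl) (use onb_orthonormal[OF u] ij in auto)
    also have "\<dots> = complex_of_real (m j) * (if i = j then 1 else 0)"
      using ij by (simp only: sum_delta_lessThan lessThan_iff)
    finally show ?thesis by simp
  qed
  have "X $$ (a, b) = (\<Sum>k<r. y k a * cnj (y k b))" if ab: "a < n" "b < n" for a b
  proof -
    have "(\<Sum>k<r. y k a * cnj (y k b)) = (\<Sum>k<r. \<Sum>i<r. \<Sum>j<r. x i a * cnj (x j b) * (u k i * cnj (u k j)))"
      by (simp add: y_def sum_product mult_ac)
    also have "\<dots> = (\<Sum>i<r. \<Sum>j<r. \<Sum>k<r. x i a * cnj (x j b) * (u k i * cnj (u k j)))"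
      by (rule sum_rotate[symmetric])
    also have "\<dots> = (\<Sum>i<r. \<Sum>j<r. x i a * cnj (x j b) * (if i = j then 1 else 0))"
      unfolding sum_distrib_left[symmetric]
      by (intro sum.cong refl arg_cong2[where f = "(*)"]) (use onb_complete[OF u] in auto)
    also have "\<dots> = (\<Sum>i<r. x i a * cnj (x i b))"
      by (intro sum.cong refl) (simp only: sum_delta_lessThan lessThan_iff)
    finally show ?thesis using X_eq[OF ab] by simp
  qed
  from entropy_orthogonal_sum[OF X this _ y_orth]
  have ent: "entropy X = (\<Sum>k<r. eta (m k))" by simp
  have m_nonneg: "0 \<le> m k" if "k < r" for k
  proof -
    have "complex_of_real (m k) = cip n (y k) (y k)" using y_orth[of k k] that by simp
    then have "m k = (\<Sum>a<n. (cmod (y k a))\<^sup>2)" unfolding cip_self using of_real_eq_iff by blast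
    then show ?thesis by (simp add: sum_nonneg)
  qed
  \<comment> \<open>A doubly stochastic matrix. It expresses the diagonal of \<open>G\<close>, which
    is all that the claimed bound sees, through the eigenvalues \<open>m\<close>.\<close>
  define P where "P k i = (cmod (u k i))\<^sup>2" for k i
  have P_row: "(\<Sum>i<r. P k i) = 1" if "k < r" for k
  proof -
    have "complex_of_real (\<Sum>i<r. P k i) = 1"
      using onb_orthonormal[OF u that that] unfolding cip_self P_def by simp
    then show ?thesis using of_real_eq_1_iff by blast
  qed
  have P_col: "(\<Sum>k<r. P k i) = 1" if "i < r" for i
  proof -
    have "complex_of_real (\<Sum>k<r. P k i) = 1"
      using onb_complete[OF u that that] unfolding P_def by (simp add: complex_norm_square[symmetric])
    then show ?thesis using of_real_eq_1_iff by blast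
  qed
  have diag: "Re (cip n (x i) (x i)) = (\<Sum>k<r. P k i * m k)" if "i < r" for i
  proof -
    have "cip n (x i) (x i) = (\<Sum>k<r. complex_of_real (P k i * m k))"
      using G_eq[OF that that] unfolding G_def P_def
      by (simp add: complex_norm_square mult_ac del: of_real_power)
    then show ?thesis by simp
  qed
  have m_sum: "(\<Sum>k<r. m k) = 1"
  proof -
    have "1 = (\<Sum>i<r. \<Sum>k<r. P k i * m k)" using tr diag by simp
    also have "\<dots> = (\<Sum>k<r. (\<Sum>i<r. P k i) * m k)" unfolding sum_distrib_right by (rule sum.swap)
    also have "\<dots> = (\<Sum>k<r. m k)" using P_row by simp
    finally show ?thesis by simp
  qed
  define g where "g k i = m k * log 2 (m k) - m k * log 2 (l i) - (m k - l i) / ln 2" for k i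
  have g_nonneg: "0 \<le> g k i" if "k < r" "i < r" for k i
    using relative_entropy_summand(1)[OF m_nonneg l_pos, OF that] by (simp add: g_def)
  \<comment> \<open>The gap is a relative entropy. The terms with \<open>m k / ln 2\<close> and
    \<open>l i / ln 2\<close> cancel since \<open>P\<close> is doubly stochastic and both
    \<open>m\<close> and \<open>l\<close> sum to one.\<close>
  have gap: "(\<Sum>k<r. Re (cip n (x k) (x k)) * (- log 2 (l k))) - entropy X = (\<Sum>k<r. \<Sum>i<r. P k i * g k i)"
  proof -
    have 1: "(\<Sum>k<r. Re (cip n (x k) (x k)) * (- log 2 (l k))) = (\<Sum>k<r. \<Sum>i<r. P k i * (m k * (- log 2 (l i))))"
      by (subst sum.swap, rule sum.cong[OF refl])
        (simp only: diag sum_distrib_right mult.assoc lessThan_iff)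
    have 2: "(\<Sum>k<r. \<Sum>i<r. P k i * c k) = (\<Sum>k<r. c k)" for c
      unfolding sum_distrib_right[symmetric] using P_row by simp
    have 3: "(\<Sum>k<r. \<Sum>i<r. P k i * c i) = (\<Sum>i<r. c i)" for c
      by (subst sum.swap) (use P_col in \<open>simp add: sum_distrib_right[symmetric]\<close>)
    have "(\<Sum>k<r. \<Sum>i<r. P k i * g k i) =
      (\<Sum>k<r. \<Sum>i<r. P k i * (m k * (- log 2 (l i)))) + (\<Sum>k<r. \<Sum>i<r. P k i * (m k * log 2 (m k)))
      - (\<Sum>k<r. \<Sum>i<r. P k i * (m k / ln 2)) + (\<Sum>k<r. \<Sum>i<r. P k i * (l i / ln 2))"
      unfolding sum.distrib[symmetric] sum_subtractf[symmetric]
      by (intro sum.cong refl) (simp add: g_def algebra_simps diff_divide_distrib)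
    also have "\<dots> = (\<Sum>k<r. \<Sum>i<r. P k i * (m k * (- log 2 (l i)))) - entropy X"
      unfolding 2 3 ent eta_def by (simp add: sum_divide_distrib[symmetric] m_sum l_sum sum_negf)
    finally show ?thesis using 1 by simp
  qed
  have Pg: "0 \<le> P k i * g k i" if "k < r" "i < r" for k i
    using g_nonneg[OF that] by (simp add: P_def)
  then have "0 \<le> (\<Sum>k<r. \<Sum>i<r. P k i * g k i)" by (intro sum_nonneg) auto
  then show ?le using gap by linarith
  show "cip n (x i) (x j) = (if i = j then complex_of_real (l i) else 0)"
    if eq: ?eq and ij: "i < r" "j < r"
  proof -
    have "(\<Sum>k<r. \<Sum>i<r. P k i * g k i) = 0" using gap eq by linarith
    then have "\<forall>k\<in>{..<r}. (\<Sum>i<r. P k i * g k i) = 0"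
      by (subst (asm) sum_nonneg_eq_0_iff) (auto intro!: sum_nonneg Pg)
    then have z: "P k i * g k i = 0" if "k < r" "i < r" for k i
      using that sum_nonneg_eq_0_iff[of "{..<r}" "\<lambda>i. P k i * g k i"] Pg by auto
    \<comment> \<open>Each eigenvector of \<open>G\<close> is thus an eigenvector of the diagonal
      matrix of \<open>l\<close> with the same eigenvalue, so the two matrices agree.\<close>
    have *: "complex_of_real (m k) * u k i = complex_of_real (l i) * u k i" if "k < r" "i < r" for k i
    proof (cases "u k i = 0")
      case False
      then have "g k i = 0" using z[OF that] by (simp add: P_def)
      then have "m k = l i"
        using relative_entropy_summand(2)[OF m_nonneg l_pos, OF that] by (simp add: g_def)
      then show ?thesis by simp
    qed simp
    have "cip n (x i) (x j) = (\<Sum>k<r. complex_of_real (m k) * u k j * cnj (u k i))"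
      using G_eq[of j i] ij unfolding G_def by simp
    also have "\<dots> = (\<Sum>k<r. complex_of_real (l j) * (u k j * cnj (u k i)))"
      by (intro sum.cong refl) (use * ij in \<open>auto simp: mult.assoc[symmetric]\<close>)
    also have "\<dots> = complex_of_real (l j) * (if j = i then 1 else 0)"
      unfolding sum_distrib_left[symmetric] using onb_complete[OF u ij(2,1)] by simp
    finally show ?thesis by simp
  qed
qed

section \<open>Product indices and the spectra of density matrices\<close>

lemma sum_prod_index: "(\<Sum>x<m * n. f x) = (\<Sum>a<m. \<Sum>b<n. f (a * n + b))"
  for f :: "nat \<Rightarrow> 'a::comm_monoid_add"
  unfolding sum.nat_group[symmetric]
  by (rule sum.cong[OF refl]) (subst sum.atLeastLessThan_shift_0, simp add: lessThan_atLeast0)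

lemma prod_index_less: "a < m \<Longrightarrow> b < n \<Longrightarrow> a * n + b < m * (n::nat)"
proof -
  assume "a < m" "b < n"
  then have "a * n + b < Suc a * n" by simp
  also have "\<dots> \<le> m * n" using \<open>a < m\<close> by (intro mult_le_mono1) simp
  finally show ?thesis .
qed

lemma kron_carrier: "X \<in> carrier_mat m n \<Longrightarrow> Y \<in> carrier_mat k l \<Longrightarrow> kron X Y \<in> carrier_mat (m * k) (n * l)"
  by (auto simp: kron_def)

lemma kron_index:
  assumes "X \<in> carrier_mat m n" "Y \<in> carrier_mat k l" "a < m" "b < k" "c < n" "d < l"
  shows "kron X Y $$ (a * k + b, c * l + d) = X $$ (a, c) * Y $$ (b, d)"
  using assms prod_index_less[of a m b k] prod_index_less[of c n d l] by (auto simp: kron_def)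

lemma psd_mat_trace_nonneg:
  assumes "psd_mat n X" shows "0 \<le> Re (mat_trace X)"
proof -
  have "0 \<le> Re (X $$ (i, i))" if "i < n" for i
  proof -
    have "(\<Sum>a<n. \<Sum>b<n. cnj (if a = i then 1 else 0) * X $$ (a, b) * (if b = i then 1 else 0)) =
      (\<Sum>a<n. (if a = i then 1 else 0) * X $$ (a, i))"
      using that by (intro sum.cong refl) (auto simp only: sum_delta_lessThan complex_cnj_one complex_cnj_zero split: if_splits)
    also have "\<dots> = X $$ (i, i)" using that by (simp only: sum_delta_lessThan)
    finally show ?thesis using psd_mat_form[OF assms, of "\<lambda>b. if b = i then 1 else 0"] by simp
  qed
  moreover have "dim_row X = n" using assms by (auto simp: psd_mat_def)
  ultimately show ?thesis unfolding mat_trace_def by (auto intro!: sum_nonneg)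
qed

lemma psd_mat_trace_real:
  assumes "psd_mat n X" shows "mat_trace X = complex_of_real (Re (mat_trace X))"
proof -
  have "dim_row X = n" using assms by (auto simp: psd_mat_def)
  moreover have "cnj (X $$ (i, i)) = X $$ (i, i)" if "i < n" for i
    using psd_mat_hermitian[OF assms] that by (simp add: hermitian_form_def)
  ultimately have "cnj (mat_trace X) = mat_trace X" by (simp add: mat_trace_def)
  then show ?thesis by (simp add: complex_eq_iff)
qed

text \<open>The eigenvectors scaled by \<open>sqrt (d i)\<close> are orthogonal and decompose
  \<sigma>, so \<open>entropy_orthogonal_sum\<close> evaluates the entropy on this eigensystem,
  whichever one the definition of \<open>mat_fun\<close> picked.\<close>

lemma density_spectral:
  assumes "density_mat n \<sigma>"
  obtains u d r where "psd_eigensystem n (\<lambda>a b. \<sigma> $$ (a, b)) u d r" "(\<Sum>i<r. d i) = 1"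
    "entropy \<sigma> = (\<Sum>i<r. eta (d i))"
proof -
  have psd: "psd_mat n \<sigma>" and tr: "mat_trace \<sigma> = 1" using assms by (auto simp: density_mat_def)
  have c: "\<sigma> \<in> carrier_mat n n" using psd by (simp add: psd_mat_def)
  obtain u d r where es: "psd_eigensystem n (\<lambda>a b. \<sigma> $$ (a, b)) u d r"
    using psd by (rule psd_spectral)
  note eq = psd_eigensystem_eq[OF es]
  have u: "onb n u" and r: "r \<le> n" and pos: "\<And>i. i < r \<Longrightarrow> 0 < d i"
    using es by (auto simp: psd_eigensystem_def eigensystem_def)
  have "mat_trace \<sigma> = (\<Sum>a<n. \<Sum>i<r. complex_of_real (d i) * (u i a * cnj (u i a)))"
    using c by (auto simp: mat_trace_def eq mult.assoc intro!: sum.cong)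
  also have "\<dots> = (\<Sum>i<r. complex_of_real (d i) * cip n (u i) (u i))"
    unfolding cip_def sum_distrib_left by (rule sum.swap)
  also have "\<dots> = complex_of_real (\<Sum>i<r. d i)"
    using onb_orthonormal[OF u] r by simp
  finally have "complex_of_real (\<Sum>i<r. d i) = 1" using tr by simp
  then have "(\<Sum>i<r. d i) = 1" using of_real_eq_1_iff by blast
  moreover have "entropy \<sigma> = (\<Sum>i\<in>{..<r}. eta (d i))"
  proof (rule entropy_orthogonal_sum[OF c])
    have sq: "complex_of_real (sqrt (d i)) * complex_of_real (sqrt (d i)) = complex_of_real (d i)" if "i < r" for i
      using pos[OF that] by (simp add: of_real_mult[symmetric] del: of_real_mult)
    show "\<sigma> $$ (a, b) = (\<Sum>i<r. complex_of_real (sqrt (d i)) * u i a * cnj (complex_of_real (sqrt (d i)) * u i b))"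
      if "a < n" "b < n" for a b
      unfolding eq[OF that] by (intro sum.cong refl) (simp only: sq[symmetric] complex_cnj_mult complex_cnj_complex_of_real mult_ac lessThan_iff)
    show "cip n (\<lambda>a. complex_of_real (sqrt (d i)) * u i a) (\<lambda>a. complex_of_real (sqrt (d j)) * u j a) =
      (if i = j then complex_of_real (d j) else 0)" if "i \<in> {..<r}" "j \<in> {..<r}" for i j
      unfolding cip_scale using onb_orthonormal[OF u, of i j] that r sq by auto
  qed simp
  ultimately show ?thesis using es that by blast
qed

lemma entropy_nonneg:
  assumes "density_mat n \<sigma>" shows "0 \<le> entropy \<sigma>"
proof -
  obtain u d r where es: "psd_eigensystem n (\<lambda>a b. \<sigma> $$ (a, b)) u d r" and s: "(\<Sum>i<r. d i) = 1"
    and e: "entropy \<sigma> = (\<Sum>i<r. eta (d i))"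
    using assms by (rule density_spectral)
  have pos: "0 < d i" if "i < r" for i using es that by (auto simp: psd_eigensystem_def)
  have "d i \<le> 1" if "i < r" for i
    using member_le_sum[of i "{..<r}" d] s pos that by (auto intro: less_imp_le)
  then show ?thesis unfolding e using pos by (intro sum_nonneg eta_nonneg) (auto intro: less_imp_le)
qed

section \<open>Measurements\<close>

text \<open>
  The vector number k of the ensemble, with weight \<open>l k\<close>, is stored as the \<open>dA \<times> dB\<close> matrix \<open>M k\<close>.
\<close>

definition ensemble ::
    "nat \<Rightarrow> nat \<Rightarrow> complex mat \<Rightarrow> nat \<Rightarrow> (nat \<Rightarrow> real) \<Rightarrow> (nat \<Rightarrow> nat \<Rightarrow> nat \<Rightarrow> complex) \<Rightarrow> bool" where
  "ensemble dA dB \<rho> r l M \<longleftrightarrow> (\<forall>k<r. 0 < l k) \<and> (\<Sum>k<r. l k) = 1 \<and>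
     (\<forall>k<r. \<forall>j<r. (\<Sum>a<dA. cip dB (M k a) (M j a)) = (if k = j then 1 else 0)) \<and>
     (\<forall>a<dA. \<forall>b<dB. \<forall>a'<dA. \<forall>b'<dB. \<rho> $$ (a * dB + b, a' * dB + b') =
        (\<Sum>k<r. complex_of_real (l k) * M k a b * cnj (M k a' b')))"

lemma density_ensemble:
  assumes "density_mat (dA * dB) \<rho>"
  obtains r l M where "ensemble dA dB \<rho> r l M" "entropy \<rho> = (\<Sum>k<r. eta (l k))"
proof -
  obtain u l r where es: "psd_eigensystem (dA * dB) (\<lambda>a b. \<rho> $$ (a, b)) u l r"
    and s: "(\<Sum>i<r. l i) = 1" and e: "entropy \<rho> = (\<Sum>i<r. eta (l i))"
    using assms by (rule density_spectral)
  have u: "onb (dA * dB) u" and r: "r \<le> dA * dB" and pos: "\<And>i. i < r \<Longrightarrow> 0 < l i"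
    using es by (auto simp: psd_eigensystem_def eigensystem_def)
  define M where "M k a b = u k (a * dB + b)" for k a b
  have "(\<Sum>a<dA. cip dB (M k a) (M j a)) = cip (dA * dB) (u k) (u j)" for k j
    unfolding cip_def M_def sum_prod_index by (rule refl)
  then have "ensemble dA dB \<rho> r l M"
    unfolding ensemble_def using s pos r onb_orthonormal[OF u]
    by (auto simp: psd_eigensystem_eq[OF es] prod_index_less M_def)
  then show ?thesis using e that by blast
qed

text \<open>The post-measurement state before division by the outcome probability, which is its
  trace. It remains meaningful for outcomes of probability zero.\<close>

definition post_op :: "nat \<Rightarrow> nat \<Rightarrow> complex mat \<Rightarrow> complex mat \<Rightarrow> complex mat" where
  "post_op dA dB \<rho> E = ptrace_B dA dB (kron (1\<^sub>m dA) E * \<rho>)"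

lemma post_op_carrier [simp, intro]: "post_op dA dB \<rho> E \<in> carrier_mat dA dA"
  by (simp add: post_op_def ptrace_B_def)

lemma post_op_dim [simp]:
  "dim_row (post_op dA dB \<rho> E) = dA" "dim_col (post_op dA dB \<rho> E) = dA"
  by (simp_all add: post_op_def ptrace_B_def)

lemma post_op_index:
  assumes \<rho>: "\<rho> \<in> carrier_mat (dA * dB) (dA * dB)" and E: "E \<in> carrier_mat dB dB" and a: "a < dA" "a' < dA"
  shows "post_op dA dB \<rho> E $$ (a, a') =
    (\<Sum>b<dB. \<Sum>c<dB. E $$ (b, c) * \<rho> $$ (a * dB + c, a' * dB + b))"
proof -
  have "(kron (1\<^sub>m dA) E * \<rho>) $$ (a * dB + b, a' * dB + b) =
    (\<Sum>c<dB. E $$ (b, c) * \<rho> $$ (a * dB + c, a' * dB + b))" if b: "b < dB" for b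
  proof -
    have "(kron (1\<^sub>m dA) E * \<rho>) $$ (a * dB + b, a' * dB + b) =
      (\<Sum>x<dA * dB. kron (1\<^sub>m dA) E $$ (a * dB + b, x) * \<rho> $$ (x, a' * dB + b))"
      by (rule mat_mult_index[OF kron_carrier[OF one_carrier_mat E] \<rho>]) (use a b prod_index_less in auto)
    also have "\<dots> = (\<Sum>e<dA. \<Sum>c<dB. kron (1\<^sub>m dA) E $$ (a * dB + b, e * dB + c) * \<rho> $$ (e * dB + c, a' * dB + b))"
      by (rule sum_prod_index)
    also have "\<dots> = (\<Sum>e<dA. (if a = e then 1 else 0) * (\<Sum>c<dB. E $$ (b, c) * \<rho> $$ (e * dB + c, a' * dB + b)))"
      unfolding sum_distrib_left
      by (intro sum.cong refl) (use a b in \<open>simp add: kron_index[OF one_carrier_mat E]\<close>)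
    also have "\<dots> = (\<Sum>c<dB. E $$ (b, c) * \<rho> $$ (a * dB + c, a' * dB + b))"
      using a by (simp only: sum_delta_lessThan)
    finally show ?thesis .
  qed
  then show ?thesis using a by (simp add: post_op_def ptrace_B_def)
qed

lemma outcome_prob_eq:
  assumes "\<rho> \<in> carrier_mat (dA * dB) (dA * dB)" "E \<in> carrier_mat dB dB"
  shows "outcome_prob dA \<rho> E = Re (mat_trace (post_op dA dB \<rho> E))"
proof -
  have "dim_row (kron (1\<^sub>m dA) E * \<rho>) = dA * dB" using assms by (auto simp: kron_def)
  then show ?thesis
    unfolding outcome_prob_def mat_trace_def
    by (simp add: sum_prod_index post_op_def ptrace_B_def)
qed

lemma post_state_eq:
  "post_state dA dB \<rho> E = complex_of_real (1 / outcome_prob dA \<rho> E) \<cdot>\<^sub>m post_op dA dB \<rho> E"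
  by (simp add: post_state_def post_op_def)

lemma post_state_carrier [simp, intro]: "post_state dA dB \<rho> E \<in> carrier_mat dA dA"
  by (simp add: post_state_eq)

lemma post_state_index:
  "a < dA \<Longrightarrow> b < dA \<Longrightarrow>
    post_state dA dB \<rho> E $$ (a, b) = complex_of_real (1 / outcome_prob dA \<rho> E) * post_op dA dB \<rho> E $$ (a, b)"
  by (simp add: post_state_eq)

text \<open>Polarization over bases instead of single vectors, because a measurement supplies a
  whole basis. Expanding a Hermitian \<open>H\<close> in its eigenbasis shows that the trace of
  \<open>H\<close> times \<open>D\<close> vanishes. With matrix units \<open>e\<close>, the
  Hermitian matrices \<open>e p q + e q p\<close> and \<open>\<i> * (e p q - e q p)\<close> then
  isolate the sum and the difference of \<open>D q p\<close> and \<open>D p q\<close>.\<close>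

lemma form_zero_on_onb:
  fixes D :: "nat \<Rightarrow> nat \<Rightarrow> complex"
  assumes zero: "\<And>w i. onb n w \<Longrightarrow> i < n \<Longrightarrow> (\<Sum>b<n. \<Sum>c<n. cnj (w i b) * D b c * w i c) = 0"
    and pq: "p < n" "q < n"
  shows "D p q = 0"
proof -
  have herm: "(\<Sum>b<n. \<Sum>c<n. H c b * D b c) = 0" if H: "hermitian_form n H" for H
  proof -
    obtain w d where es: "eigensystem n H w d" using H by (rule spectral_theorem)
    have "(\<Sum>b<n. \<Sum>c<n. H c b * D b c) =
      (\<Sum>b<n. \<Sum>c<n. \<Sum>i<n. complex_of_real (d i) * (cnj (w i b) * D b c * w i c))"
      by (intro sum.cong refl) (simp add: eigensystem_eq[OF es] sum_distrib_left sum_distrib_right mult_ac)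
    also have "\<dots> = (\<Sum>i<n. \<Sum>b<n. \<Sum>c<n. complex_of_real (d i) * (cnj (w i b) * D b c * w i c))"
      by (rule sum_rotate)
    also have "\<dots> = (\<Sum>i<n. complex_of_real (d i) * (\<Sum>b<n. \<Sum>c<n. cnj (w i b) * D b c * w i c))"
      by (simp only: sum_distrib_left)
    also have "\<dots> = 0" using zero[OF eigensystem_onb[OF es]] by simp
    finally show ?thesis .
  qed
  define e where "e s t c b = (if c = s then 1 else 0 :: complex) * (if b = t then 1 else 0)" for s t c b :: nat
  have cnj_e: "cnj (e s t c b) = e t s b c" for s t c b by (auto simp: e_def)
  have sum_e: "(\<Sum>b<n. \<Sum>c<n. e s t c b * D b c) = D t s" if "s < n" "t < n" for s t
  proof -
    have "(\<Sum>b<n. \<Sum>c<n. e s t c b * D b c) = (\<Sum>b<n. (if b = t then 1 else 0) * (\<Sum>c<n. (if c = s then 1 else 0) * D b c))"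
      unfolding sum_distrib_left e_def by (simp only: mult_ac)
    then show ?thesis using that by (simp only: sum_delta_lessThan)
  qed
  have "(\<Sum>b<n. \<Sum>c<n. (e p q c b + e q p c b) * D b c) = 0"
    by (rule herm) (simp add: hermitian_form_def cnj_e)
  then have "D q p + D p q = 0" using sum_e pq by (simp add: distrib_right sum.distrib)
  moreover have "(\<Sum>b<n. \<Sum>c<n. (\<i> * e p q c b - \<i> * e q p c b) * D b c) = 0"
    by (rule herm) (simp add: hermitian_form_def cnj_e)
  then have "\<i> * D q p - \<i> * D p q = 0"
    using sum_e pq by (simp add: left_diff_distrib sum_subtractf mult.assoc sum_distrib_left[symmetric])
  ultimately show ?thesis by (simp add: right_diff_distrib[symmetric] add_eq_0_iff)
qed

lemma psd_mat_gram:
  fixes x :: "'k \<Rightarrow> nat \<Rightarrow> complex"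
  assumes X: "X \<in> carrier_mat n n"
    and eq: "\<And>a b. a < n \<Longrightarrow> b < n \<Longrightarrow> X $$ (a, b) = (\<Sum>k\<in>K. x k a * cnj (x k b))"
  shows "psd_mat n X"
proof (rule psd_matI[OF X hermitian_form_orthogonal_sum[OF eq]])
  fix v
  have "(\<Sum>a<n. \<Sum>b<n. cnj (v a) * X $$ (a, b) * v b) =
    (\<Sum>a<n. \<Sum>b<n. \<Sum>k\<in>K. (x k a * cnj (v a)) * (v b * cnj (x k b)))"
    by (intro sum.cong refl) (simp add: eq sum_distrib_left sum_distrib_right mult_ac)
  also have "\<dots> = (\<Sum>k\<in>K. cip n (x k) v * cnj (cip n (x k) v))"
    unfolding cnj_cip unfolding cip_def sum_product by (rule sum_rotate)
  finally show "0 \<le> Re (\<Sum>a<n. \<Sum>b<n. cnj (v a) * X $$ (a, b) * v b)"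
    by (simp add: complex_norm_square[symmetric] sum_nonneg del: of_real_power)
qed auto

lemma povm_onb:
  assumes "onb n w"
  shows "povm n n (\<lambda>i. mat n n (\<lambda>(b, c). w i b * cnj (w i c)))"
  unfolding povm_def
proof (intro conjI allI impI)
  fix i assume "i < n"
  show "psd_mat n (mat n n (\<lambda>(b, c). w i b * cnj (w i c)))"
    by (rule psd_mat_gram[of _ _ w "{i}"]) auto
next
  show "mat n n (\<lambda>(b, c). \<Sum>i<n. mat n n (\<lambda>(b, c). w i b * cnj (w i c)) $$ (b, c)) = 1\<^sub>m n"
    by (rule eq_matI) (auto simp: onb_complete[OF assms])
qed

section \<open>Post-measurement states in terms of an ensemble\<close>

context
  fixes dA dB r :: nat and \<rho> :: "complex mat" and l :: "nat \<Rightarrow> real" and M :: "nat \<Rightarrow> nat \<Rightarrow> nat \<Rightarrow> complex"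
  assumes \<rho>: "\<rho> \<in> carrier_mat (dA * dB) (dA * dB)" and ens: "ensemble dA dB \<rho> r l M"
begin

lemma ensemble_weight_pos: "k < r \<Longrightarrow> 0 < l k"
  and ensemble_weight_sum: "(\<Sum>k<r. l k) = 1"
  and ensemble_orthonormal: "k < r \<Longrightarrow> j < r \<Longrightarrow> (\<Sum>a<dA. cip dB (M k a) (M j a)) = (if k = j then 1 else 0)"
  and ensemble_state_eq: "a < dA \<Longrightarrow> b < dB \<Longrightarrow> a' < dA \<Longrightarrow> b' < dB \<Longrightarrow>
    \<rho> $$ (a * dB + b, a' * dB + b') = (\<Sum>k<r. complex_of_real (l k) * M k a b * cnj (M k a' b'))"
  using ens by (simp_all add: ensemble_def)

lemma post_op_ensemble:
  assumes E: "E \<in> carrier_mat dB dB" and a: "a < dA" "a' < dA"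
  shows "post_op dA dB \<rho> E $$ (a, a') =
    (\<Sum>k<r. complex_of_real (l k) * (\<Sum>b<dB. \<Sum>c<dB. E $$ (b, c) * M k a c * cnj (M k a' b)))"
proof -
  have "post_op dA dB \<rho> E $$ (a, a') =
    (\<Sum>b<dB. \<Sum>c<dB. \<Sum>k<r. complex_of_real (l k) * (E $$ (b, c) * M k a c * cnj (M k a' b)))"
    unfolding post_op_index[OF \<rho> E a]
    by (intro sum.cong refl) (use a in \<open>simp add: ensemble_state_eq sum_distrib_left mult_ac\<close>)
  then show ?thesis by (subst (asm) sum_rotate) (simp only: sum_distrib_left)
qed

text \<open>Testing the operator on \<open>v\<close> contracts the A side of each \<open>M k\<close>
  with \<open>v\<close>. What remains is the quadratic form of \<open>E\<close> at the vector
  \<open>z k\<close> on B, taken with the positive weight \<open>l k\<close>.\<close>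

lemma psd_post_op:
  assumes psd: "psd_mat dB E"
  shows "psd_mat dA (post_op dA dB \<rho> E)"
proof (rule psd_matI)
  have E: "E \<in> carrier_mat dB dB" using psd by (simp add: psd_mat_def)
  note eq = post_op_ensemble[OF E]
  have herm: "cnj (E $$ (b, c)) = E $$ (c, b)" if "b < dB" "c < dB" for b c
    using psd_mat_hermitian[OF psd] that by (simp add: hermitian_form_def)
  show "hermitian_form dA (\<lambda>a b. post_op dA dB \<rho> E $$ (a, b))"
    unfolding hermitian_form_def
  proof (intro allI impI)
    fix a a' assume a: "a < dA" "a' < dA"
    have "cnj (post_op dA dB \<rho> E $$ (a, a')) =
      (\<Sum>k<r. complex_of_real (l k) * (\<Sum>b<dB. \<Sum>c<dB. E $$ (c, b) * cnj (M k a c) * M k a' b))"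
      unfolding eq[OF a] by (simp add: herm)
    also have "\<dots> = (\<Sum>k<r. complex_of_real (l k) * (\<Sum>b<dB. \<Sum>c<dB. E $$ (b, c) * M k a' c * cnj (M k a b)))"
      by (rule sum.cong[OF refl], rule arg_cong2[where f = "(*)", OF refl], subst sum.swap)
        (simp only: mult_ac)
    finally show "cnj (post_op dA dB \<rho> E $$ (a, a')) = post_op dA dB \<rho> E $$ (a', a)"
      unfolding eq[OF a(2,1)] .
  qed
  fix v
  define z where "z k c = cip dA (\<lambda>a. M k a c) v" for k c
  have "(\<Sum>a<dA. \<Sum>a'<dA. cnj (v a) * post_op dA dB \<rho> E $$ (a, a') * v a') =
    (\<Sum>a<dA. \<Sum>a'<dA. \<Sum>k<r. complex_of_real (l k) * (\<Sum>b<dB. \<Sum>c<dB. E $$ (b, c) * (M k a c * cnj (v a)) * (v a' * cnj (M k a' b))))"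
    by (intro sum.cong refl) (simp add: eq sum_distrib_left sum_distrib_right mult_ac)
  also have "\<dots> = (\<Sum>k<r. complex_of_real (l k) * (\<Sum>a<dA. \<Sum>a'<dA. \<Sum>b<dB. \<Sum>c<dB. E $$ (b, c) * (M k a c * cnj (v a)) * (v a' * cnj (M k a' b))))"
    by (subst sum_rotate) (simp only: sum_distrib_left)
  also have "\<dots> = (\<Sum>k<r. complex_of_real (l k) * (\<Sum>b<dB. \<Sum>c<dB. cnj (z k b) * E $$ (b, c) * z k c))"
  proof (rule sum.cong[OF refl], rule arg_cong2[where f = "(*)", OF refl])
    fix k
    have "(\<Sum>a<dA. \<Sum>a'<dA. \<Sum>b<dB. \<Sum>c<dB. E $$ (b, c) * (M k a c * cnj (v a)) * (v a' * cnj (M k a' b))) =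
      (\<Sum>b<dB. \<Sum>a<dA. \<Sum>a'<dA. \<Sum>c<dB. E $$ (b, c) * (M k a c * cnj (v a)) * (v a' * cnj (M k a' b)))"
      by (rule sum_rotate)
    also have "\<dots> = (\<Sum>b<dB. \<Sum>c<dB. \<Sum>a<dA. \<Sum>a'<dA. E $$ (b, c) * (M k a c * cnj (v a)) * (v a' * cnj (M k a' b)))"
      by (rule sum.cong[OF refl], rule sum_rotate)
    also have "\<dots> = (\<Sum>b<dB. \<Sum>c<dB. E $$ (b, c) * (z k c * cnj (z k b)))"
      unfolding z_def cnj_cip unfolding cip_def sum_product
      by (simp only: sum_distrib_left mult.assoc)
    finally show "(\<Sum>a<dA. \<Sum>a'<dA. \<Sum>b<dB. \<Sum>c<dB. E $$ (b, c) * (M k a c * cnj (v a)) * (v a' * cnj (M k a' b))) =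
      (\<Sum>b<dB. \<Sum>c<dB. cnj (z k b) * E $$ (b, c) * z k c)" by (simp only: mult_ac)
  qed
  finally have form: "(\<Sum>a<dA. \<Sum>a'<dA. cnj (v a) * post_op dA dB \<rho> E $$ (a, a') * v a') =
    (\<Sum>k<r. complex_of_real (l k) * (\<Sum>b<dB. \<Sum>c<dB. cnj (z k b) * E $$ (b, c) * z k c))" .
  have "0 \<le> Re (complex_of_real (l k) * (\<Sum>b<dB. \<Sum>c<dB. cnj (z k b) * E $$ (b, c) * z k c))"
    if "k < r" for k
    using mult_nonneg_nonneg[OF less_imp_le[OF ensemble_weight_pos[OF that]] psd_mat_form[OF psd, of "z k"]]
    by (simp del: Re_sum)
  then show "0 \<le> Re (\<Sum>a<dA. \<Sum>a'<dA. cnj (v a) * post_op dA dB \<rho> E $$ (a, a') * v a')"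
    unfolding form Re_sum by (intro sum_nonneg) auto
qed (rule post_op_carrier)

lemma outcome_prob_nonneg: "psd_mat dB E \<Longrightarrow> 0 \<le> outcome_prob dA \<rho> E"
  using outcome_prob_eq[OF \<rho>, of E] psd_mat_trace_nonneg[OF psd_post_op] by (simp add: psd_mat_def)

lemma density_post_state:
  assumes psd: "psd_mat dB E" and p: "outcome_prob dA \<rho> E \<noteq> 0"
  shows "density_mat dA (post_state dA dB \<rho> E)"
proof -
  have p0: "0 < outcome_prob dA \<rho> E" using outcome_prob_nonneg[OF psd] p by simp
  note psdT = psd_post_op[OF psd]
  have tr: "mat_trace (post_op dA dB \<rho> E) = complex_of_real (outcome_prob dA \<rho> E)"
    using psd_mat_trace_real[OF psdT] outcome_prob_eq[OF \<rho>, of E] psd by (simp add: psd_mat_def)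
  have "dim_row (post_op dA dB \<rho> E) = dA" "dim_row (post_state dA dB \<rho> E) = dA"
    using post_op_carrier post_state_carrier by blast+
  then have "mat_trace (post_state dA dB \<rho> E) = complex_of_real (1 / outcome_prob dA \<rho> E) * mat_trace (post_op dA dB \<rho> E)"
    by (simp add: mat_trace_def post_state_index sum_distrib_left)
  then have "mat_trace (post_state dA dB \<rho> E) = 1" using tr p by simp
  moreover have "psd_mat dA (post_state dA dB \<rho> E)"
  proof (rule psd_matI)
    show "hermitian_form dA (\<lambda>a b. post_state dA dB \<rho> E $$ (a, b))"
      using psd_mat_hermitian[OF psdT] by (simp add: hermitian_form_def post_state_index)
    fix v
    have "(\<Sum>a<dA. \<Sum>b<dA. cnj (v a) * post_state dA dB \<rho> E $$ (a, b) * v b) =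
      complex_of_real (1 / outcome_prob dA \<rho> E) * (\<Sum>a<dA. \<Sum>b<dA. cnj (v a) * post_op dA dB \<rho> E $$ (a, b) * v b)"
      unfolding sum_distrib_left by (intro sum.cong refl) (simp add: post_state_index)
    then show "0 \<le> Re (\<Sum>a<dA. \<Sum>b<dA. cnj (v a) * post_state dA dB \<rho> E $$ (a, b) * v b)"
      using psd_mat_form[OF psdT, of v] p0 by (simp only: Re_complex_of_real times_complex.sel Im_complex_of_real) simp
  qed (rule post_state_carrier)
  ultimately show ?thesis by (simp add: density_mat_def)
qed

text \<open>Holds because post-measurement entropies are nonnegative. This crude bound makes the set
  of gains bounded above, without which nothing could be concluded from its
  \<open>Sup\<close>.\<close>

lemma information_gain_le:
  assumes "povm dB n E"
  shows "information_gain dA dB \<rho> n E \<le> entropy (ptrace_B dA dB \<rho>)"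
  unfolding information_gain_def
  using assms by (auto simp: povm_def intro!: sum_nonneg mult_nonneg_nonneg outcome_prob_nonneg entropy_nonneg density_post_state)

lemma bdd_above_information_gain: "bdd_above {information_gain dA dB \<rho> n E | n E. povm dB n E}"
  using information_gain_le by (intro bdd_aboveI[where M = "entropy (ptrace_B dA dB \<rho>)"]) auto

lemma ptrace_A_ensemble:
  assumes "b < dB" "c < dB"
  shows "ptrace_A dA dB \<rho> $$ (b, c) = (\<Sum>k<r. complex_of_real (l k) * (\<Sum>a<dA. M k a b * cnj (M k a c)))"
  unfolding ptrace_A_def using assms
  by (simp add: ensemble_state_eq sum_distrib_left mult.assoc) (rule sum.swap)

end

lemma eigensystem_form:
  assumes es: "eigensystem n X u d" and ij: "i < n" "j < n"
  shows "(\<Sum>b<n. \<Sum>c<n. cnj (u i b) * X b c * u j c) = (if i = j then complex_of_real (d i) else 0)"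
proof -
  note u = onb_orthonormal[OF eigensystem_onb[OF es]]
  have "(\<Sum>b<n. \<Sum>c<n. cnj (u i b) * X b c * u j c) =
    (\<Sum>b<n. \<Sum>c<n. \<Sum>k<n. complex_of_real (d k) * ((u k b * cnj (u i b)) * (u j c * cnj (u k c))))"
    by (intro sum.cong refl) (simp add: eigensystem_eq[OF es] sum_distrib_left sum_distrib_right mult_ac)
  also have "\<dots> = (\<Sum>k<n. complex_of_real (d k) * (cip n (u k) (u i) * cip n (u j) (u k)))"
    unfolding cip_def sum_product by (subst sum_rotate) (simp only: sum_distrib_left)
  also have "\<dots> = (\<Sum>k<n. (if k = i then 1 else 0) * (complex_of_real (d k) * (if j = k then 1 else 0)))"
    by (intro sum.cong refl) (use u ij in auto)
  also have "\<dots> = complex_of_real (d i) * (if j = i then 1 else 0)"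
    using ij by (simp only: sum_delta_lessThan)
  finally show ?thesis by auto
qed

text \<open>The bridge from slices on A to operators on B. For \<open>K = M k\<close> and
  \<open>L = M j\<close> the inner sum is the matrix of the partial trace over A of |v k><v j|, so
  inner products of slices along \<open>x\<close> and \<open>y\<close> are its matrix
  elements.\<close>

lemma cip_slices:
  "cip m (\<lambda>a. cip n (K a) x) (\<lambda>a. cip n (L a) y) =
    (\<Sum>b<n. \<Sum>c<n. cnj (x b) * (\<Sum>a<m. K a b * cnj (L a c)) * y c)"
proof -
  have "cip m (\<lambda>a. cip n (K a) x) (\<lambda>a. cip n (L a) y) = (\<Sum>a<m. cip n (K a) x * cip n y (L a))"
    by (simp add: cip_def[of m] cnj_cip)
  also have "\<dots> = (\<Sum>a<m. \<Sum>b<n. \<Sum>c<n. (K a b * cnj (x b)) * (y c * cnj (L a c)))"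
    unfolding cip_def sum_product by (rule refl)
  also have "\<dots> = (\<Sum>b<n. \<Sum>c<n. \<Sum>a<m. (K a b * cnj (x b)) * (y c * cnj (L a c)))"
    by (rule sum_rotate[symmetric, of "\<lambda>b c a. (K a b * cnj (x b)) * (y c * cnj (L a c))"])
  finally show ?thesis by (simp add: sum_distrib_left sum_distrib_right mult_ac)
qed

section \<open>Measurement of B in an orthonormal basis\<close>

context
  fixes dA dB r :: nat and \<rho> :: "complex mat" and l :: "nat \<Rightarrow> real" and M :: "nat \<Rightarrow> nat \<Rightarrow> nat \<Rightarrow> complex"
  assumes \<rho>: "\<rho> \<in> carrier_mat (dA * dB) (dA * dB)" and ens: "ensemble dA dB \<rho> r l M"
begin

lemmas ensemble_facts = ensemble_weight_pos[OF \<rho> ens] ensemble_weight_sum[OF \<rho> ens]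
  ensemble_orthonormal[OF \<rho> ens] ensemble_state_eq[OF \<rho> ens]

text \<open>
  The slice \<open>s i k\<close> is the vector on A left over when B is projected onto \<open>w i\<close> in the vector number k
  of the ensemble, so that \<open>s i k\<close> with weights \<open>l k / p i\<close> make up the post-measurement state.
\<close>

context
  fixes w :: "nat \<Rightarrow> nat \<Rightarrow> complex" and E s p N
  assumes w: "onb dB w"
  defines "E \<equiv> (\<lambda>i. mat dB dB (\<lambda>(b, c). w i b * cnj (w i c)))"
    and "s \<equiv> (\<lambda>i k a. cip dB (M k a) (w i))"
    and "p \<equiv> (\<lambda>i. outcome_prob dA \<rho> (E i))"
    and "N \<equiv> (\<lambda>i k. Re (cip dA (s i k) (s i k)))"
begin

lemma rank_one_carrier: "E i \<in> carrier_mat dB dB"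
  by (simp add: E_def)

lemma slice_norm_complex: "cip dA (s i k) (s i k) = complex_of_real (N i k)"
  unfolding N_def by (simp add: cip_self)

lemma slice_norm_nonneg: "0 \<le> N i k"
  unfolding N_def by (simp add: cip_self sum_nonneg)

lemma slice_norm_zero: "N i k = 0 \<Longrightarrow> a < dA \<Longrightarrow> s i k a = 0"
  unfolding N_def by (simp add: cip_self sum_nonneg_eq_0_iff)

lemma post_op_rank_one:
  assumes a: "a < dA" "a' < dA"
  shows "post_op dA dB \<rho> (E i) $$ (a, a') = (\<Sum>k<r. complex_of_real (l k) * (s i k a * cnj (s i k a')))"
  unfolding post_op_ensemble[OF \<rho> ens rank_one_carrier a]
proof (rule sum.cong[OF refl], rule arg_cong2[where f = "(*)", OF refl])
  fix k
  have "s i k a * cnj (s i k a') = (\<Sum>c<dB. \<Sum>b<dB. (M k a c * cnj (w i c)) * (w i b * cnj (M k a' b)))"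
    unfolding s_def cnj_cip unfolding cip_def sum_product by (rule refl)
  also have "\<dots> = (\<Sum>b<dB. \<Sum>c<dB. (M k a c * cnj (w i c)) * (w i b * cnj (M k a' b)))"
    by (rule sum.swap)
  also have "\<dots> = (\<Sum>b<dB. \<Sum>c<dB. E i $$ (b, c) * M k a c * cnj (M k a' b))"
    by (intro sum.cong refl) (simp add: E_def mult_ac)
  finally show "(\<Sum>b<dB. \<Sum>c<dB. E i $$ (b, c) * M k a c * cnj (M k a' b)) = s i k a * cnj (s i k a')" ..
qed

lemma rank_one_prob_eq: "p i = (\<Sum>k<r. l k * N i k)"
proof -
  have "mat_trace (post_op dA dB \<rho> (E i)) = (\<Sum>a<dA. \<Sum>k<r. complex_of_real (l k) * (s i k a * cnj (s i k a)))"
    by (simp add: mat_trace_def post_op_rank_one)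
  also have "\<dots> = (\<Sum>k<r. complex_of_real (l k) * cip dA (s i k) (s i k))"
    unfolding cip_def sum_distrib_left by (rule sum.swap)
  also have "\<dots> = complex_of_real (\<Sum>k<r. l k * N i k)" by (simp add: slice_norm_complex)
  finally show ?thesis unfolding p_def outcome_prob_eq[OF \<rho> rank_one_carrier] by simp
qed

lemma rank_one_prob_nonneg: "0 \<le> p i"
  unfolding rank_one_prob_eq by (intro sum_nonneg mult_nonneg_nonneg slice_norm_nonneg) (simp add: ensemble_facts(1) less_imp_le)

text \<open>All weights are positive, so a null outcome kills every slice. Hence the outcomes
  omitted in \<open>information_gain\<close> may be added back without changing the sum of the
  bounds.\<close>

lemma rank_one_prob_zero: "p i = 0 \<Longrightarrow> k < r \<Longrightarrow> N i k = 0"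
proof -
  assume "p i = 0" "k < r"
  moreover have "0 \<le> l k * N i k" if "k < r" for k
    using ensemble_facts(1)[OF that] slice_norm_nonneg by simp
  ultimately have "l k * N i k = 0"
    unfolding rank_one_prob_eq by (subst (asm) sum_nonneg_eq_0_iff) auto
  then show "N i k = 0" using ensemble_facts(1)[OF \<open>k < r\<close>] by simp
qed

text \<open>Parseval over the outcomes returns the norm of the ensemble vector number
  \<open>k\<close>. This is why the bounds of the single outcomes add up to S(AB) in every
  basis.\<close>

lemma slice_norm_sum: "k < r \<Longrightarrow> (\<Sum>i<dB. N i k) = 1"
proof -
  assume k: "k < r"
  have "complex_of_real (\<Sum>i<dB. N i k) = (\<Sum>i<dB. cip dA (s i k) (s i k))"
    by (simp add: slice_norm_complex)
  also have "\<dots> = (\<Sum>a<dA. \<Sum>i<dB. s i k a * cnj (s i k a))"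
    unfolding cip_def by (rule sum.swap)
  also have "\<dots> = 1" unfolding s_def parseval[OF w] using ensemble_facts(3)[OF k k] by simp
  finally show ?thesis using of_real_eq_1_iff by blast
qed

text \<open>\<open>gram_entropy\<close> for the slices scaled by \<open>sqrt (l k / p i)\<close>,
  compared with the weights \<open>l\<close> of the original ensemble rather than with those of the
  outcome. In the equality case the scaled Gram matrix is diag l, and dividing out
  \<open>l k / p i\<close> leaves \<open>p i\<close> on the diagonal, the same for all
  \<open>k\<close>.\<close>

lemma rank_one_outcome_entropy:
  assumes p: "p i \<noteq> 0"
  shows "p i * entropy (post_state dA dB \<rho> (E i)) \<le> (\<Sum>k<r. l k * N i k * (- log 2 (l k)))"
    and "p i * entropy (post_state dA dB \<rho> (E i)) = (\<Sum>k<r. l k * N i k * (- log 2 (l k))) \<Longrightarrow>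
      k < r \<Longrightarrow> j < r \<Longrightarrow> cip dA (s i k) (s i j) = (if k = j then complex_of_real (p i) else 0)"
proof -
  have p0: "0 < p i" using p rank_one_prob_nonneg[of i] by simp
  define x where "x k a = complex_of_real (sqrt (l k / p i)) * s i k a" for k a
  have sq: "complex_of_real (sqrt (l k / p i)) * complex_of_real (sqrt (l k / p i)) = complex_of_real (l k / p i)"
    if "k < r" for k
    using ensemble_facts(1)[OF that] p0 unfolding of_real_mult[symmetric] by simp
  have x_eq: "post_state dA dB \<rho> (E i) $$ (a, b) = (\<Sum>k<r. x k a * cnj (x k b))"
    if "a < dA" "b < dA" for a b
  proof -
    have "post_state dA dB \<rho> (E i) $$ (a, b) =
      (\<Sum>k<r. complex_of_real (l k / p i) * (s i k a * cnj (s i k b)))"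
      unfolding post_state_index[OF that] post_op_rank_one[OF that] sum_distrib_left p_def by simp
    also have "\<dots> = (\<Sum>k<r. x k a * cnj (x k b))"
      unfolding x_def
      by (intro sum.cong refl) (simp only: sq[symmetric] lessThan_iff complex_cnj_mult complex_cnj_complex_of_real mult_ac)
    finally show ?thesis .
  qed
  have x_cip: "cip dA (x k) (x j) = complex_of_real (sqrt (l k / p i) * sqrt (l j / p i)) * cip dA (s i k) (s i j)" for k j
    unfolding x_def cip_scale by simp
  have x_norm: "Re (cip dA (x k) (x k)) = l k * N i k / p i" if "k < r" for k
    unfolding x_cip of_real_mult sq[OF that] slice_norm_complex by simp
  have "(\<Sum>k<r. Re (cip dA (x k) (x k))) = p i / p i"
    using x_norm unfolding rank_one_prob_eq sum_divide_distrib by simp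
  then have tr: "(\<Sum>k<r. Re (cip dA (x k) (x k))) = 1" using p by simp
  have rhs: "p i * (\<Sum>k<r. Re (cip dA (x k) (x k)) * (- log 2 (l k))) = (\<Sum>k<r. l k * N i k * (- log 2 (l k)))"
    unfolding sum_distrib_left by (intro sum.cong refl) (use p x_norm in simp)
  note gram = gram_entropy[OF post_state_carrier x_eq tr ensemble_facts(1) ensemble_facts(2)]
  show "p i * entropy (post_state dA dB \<rho> (E i)) \<le> (\<Sum>k<r. l k * N i k * (- log 2 (l k)))"
    unfolding rhs[symmetric] using gram(1) p0 by (intro mult_left_mono) auto
  show "cip dA (s i k) (s i j) = (if k = j then complex_of_real (p i) else 0)"
    if eq: "p i * entropy (post_state dA dB \<rho> (E i)) = (\<Sum>k<r. l k * N i k * (- log 2 (l k)))"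
      and kj: "k < r" "j < r"
  proof -
    have "entropy (post_state dA dB \<rho> (E i)) = (\<Sum>k<r. Re (cip dA (x k) (x k)) * (- log 2 (l k)))"
      using eq p unfolding rhs[symmetric] by simp
    then have 1: "cip dA (x k) (x j) = (if k = j then complex_of_real (l k) else 0)"
      using gram(2) kj by blast
    have nz: "complex_of_real (sqrt (l k / p i) * sqrt (l j / p i)) \<noteq> 0"
      using ensemble_facts(1) kj p0 by (auto simp: less_le)
    show ?thesis
    proof (cases "k = j")
      case True
      have "complex_of_real (l k / p i) * cip dA (s i k) (s i k) = complex_of_real (l k)"
        using 1 unfolding True x_cip of_real_mult sq[OF kj(2)] by simp
      then show ?thesis using True ensemble_facts(1)[OF kj(1)] p0 by (simp add: field_simps)
    next
      case False
      then show ?thesis using 1 nz unfolding x_cip by simp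
    qed
  qed
qed

lemma slice_entropy_sum: "(\<Sum>i\<in>{i. i < dB \<and> p i \<noteq> 0}. \<Sum>k<r. l k * N i k * (- log 2 (l k))) = (\<Sum>k<r. eta (l k))"
proof -
  have "(\<Sum>i\<in>{i. i < dB \<and> p i \<noteq> 0}. \<Sum>k<r. l k * N i k * (- log 2 (l k))) =
    (\<Sum>i<dB. \<Sum>k<r. l k * N i k * (- log 2 (l k)))"
    by (rule sum.mono_neutral_left) (use rank_one_prob_zero in auto)
  also have "\<dots> = (\<Sum>k<r. \<Sum>i<dB. l k * N i k * (- log 2 (l k)))" by (rule sum.swap)
  also have "\<dots> = (\<Sum>k<r. (\<Sum>i<dB. N i k) * eta (l k))"
    unfolding eta_def sum_distrib_right by (simp add: mult_ac)
  also have "\<dots> = (\<Sum>k<r. eta (l k))" using slice_norm_sum by simp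
  finally show ?thesis .
qed

text \<open>For the second part, termwise inequalities whose sums agree are equalities, by
  \<open>sum_mono_inv\<close>. Null outcomes do not occur in these sums, but their slices vanish, so
  the claim reads 0 = 0 there.\<close>

lemma rank_one_measurement:
  shows "entropy (ptrace_B dA dB \<rho>) - (\<Sum>k<r. eta (l k)) \<le> information_gain dA dB \<rho> dB E"
    and "information_gain dA dB \<rho> dB E \<le> entropy (ptrace_B dA dB \<rho>) - (\<Sum>k<r. eta (l k)) \<Longrightarrow>
      i < dB \<Longrightarrow> k < r \<Longrightarrow> j < r \<Longrightarrow>
      cip dA (s i k) (s i j) = (if k = j then complex_of_real (p i) else 0)"
proof -
  let ?Q = "{i. i < dB \<and> p i \<noteq> 0}"
  have gain: "information_gain dA dB \<rho> dB E =
    entropy (ptrace_B dA dB \<rho>) - (\<Sum>i\<in>?Q. p i * entropy (post_state dA dB \<rho> (E i)))"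
    unfolding information_gain_def p_def by (rule refl)
  have le: "(\<Sum>i\<in>?Q. p i * entropy (post_state dA dB \<rho> (E i))) \<le> (\<Sum>k<r. eta (l k))"
    unfolding slice_entropy_sum[symmetric] by (intro sum_mono rank_one_outcome_entropy) auto
  then show "entropy (ptrace_B dA dB \<rho>) - (\<Sum>k<r. eta (l k)) \<le> information_gain dA dB \<rho> dB E"
    unfolding gain by simp
  assume "information_gain dA dB \<rho> dB E \<le> entropy (ptrace_B dA dB \<rho>) - (\<Sum>k<r. eta (l k))"
    and ikj: "i < dB" "k < r" "j < r"
  then have eq: "(\<Sum>i\<in>?Q. p i * entropy (post_state dA dB \<rho> (E i))) =
    (\<Sum>i\<in>?Q. \<Sum>k<r. l k * N i k * (- log 2 (l k)))"
    unfolding gain slice_entropy_sum using le by simp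
  show "cip dA (s i k) (s i j) = (if k = j then complex_of_real (p i) else 0)"
  proof (cases "p i = 0")
    case True
    have "s i k a = 0" if "a < dA" for a using slice_norm_zero[OF rank_one_prob_zero[OF True ikj(2)] that] .
    then show ?thesis using True by (simp add: cip_def)
  next
    case False
    have "p i * entropy (post_state dA dB \<rho> (E i)) = (\<Sum>k<r. l k * N i k * (- log 2 (l k)))"
      by (rule sum_mono_inv[OF eq]) (use False ikj rank_one_outcome_entropy(1) in auto)
    then show ?thesis using rank_one_outcome_entropy(2)[OF False] ikj by blast
  qed
qed

lemma rank_one_prob_form: "complex_of_real (p i) = (\<Sum>b<dB. \<Sum>c<dB. cnj (w i b) * ptrace_A dA dB \<rho> $$ (b, c) * w i c)"
proof -
  have "(\<Sum>b<dB. \<Sum>c<dB. cnj (w i b) * ptrace_A dA dB \<rho> $$ (b, c) * w i c) =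
    (\<Sum>b<dB. \<Sum>c<dB. \<Sum>k<r. complex_of_real (l k) * (cnj (w i b) * (\<Sum>a<dA. M k a b * cnj (M k a c)) * w i c))"
    by (intro sum.cong refl)
      (simp add: ptrace_A_ensemble[OF \<rho> ens] sum_distrib_left sum_distrib_right mult_ac)
  also have "\<dots> = (\<Sum>k<r. complex_of_real (l k) * cip dA (s i k) (s i k))"
    unfolding s_def cip_slices by (subst sum_rotate) (simp only: sum_distrib_left)
  also have "\<dots> = complex_of_real (p i)" by (simp add: slice_norm_complex rank_one_prob_eq)
  finally show ?thesis ..
qed

end

text \<open>Says that the joint state of B and the purifying system is the product of the state on B
  and diag l. For fixed \<open>k\<close> and \<open>j\<close>, the equality case in a basis
  \<open>w\<close> makes the diagonal of the difference \<open>?D\<close> vanish in that basis; as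
  \<open>w\<close> is arbitrary, \<open>form_zero_on_onb\<close> applies.\<close>

lemma vanishing_correlation:
  assumes gain: "\<And>n E. povm dB n E \<Longrightarrow>
      information_gain dA dB \<rho> n E \<le> entropy (ptrace_B dA dB \<rho>) - (\<Sum>k<r. eta (l k))"
    and kj: "k < r" "j < r" and bc: "b < dB" "c < dB"
  shows "(\<Sum>a<dA. M k a b * cnj (M j a c)) = (if k = j then ptrace_A dA dB \<rho> $$ (b, c) else 0)"
proof -
  let ?D = "\<lambda>b c. (\<Sum>a<dA. M k a b * cnj (M j a c)) - (if k = j then ptrace_A dA dB \<rho> $$ (b, c) else 0)"
  have "?D b c = 0"
  proof (rule form_zero_on_onb[OF _ bc, where D = ?D])
    fix w :: "nat \<Rightarrow> nat \<Rightarrow> complex" and i assume w: "onb dB w" and i: "i < dB"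
    have "(\<Sum>b<dB. \<Sum>c<dB. cnj (w i b) * ?D b c * w i c) =
      (\<Sum>b<dB. \<Sum>c<dB. cnj (w i b) * (\<Sum>a<dA. M k a b * cnj (M j a c)) * w i c) -
      (if k = j then (\<Sum>b<dB. \<Sum>c<dB. cnj (w i b) * ptrace_A dA dB \<rho> $$ (b, c) * w i c) else 0)"
      by (cases "k = j") (simp_all add: right_diff_distrib left_diff_distrib sum_subtractf)
    also have "\<dots> = 0"
      unfolding cip_slices[symmetric] rank_one_prob_form[OF w, symmetric]
      using rank_one_measurement(2)[OF w gain[OF povm_onb[OF w]] i kj] by simp
    finally show "(\<Sum>b<dB. \<Sum>c<dB. cnj (w i b) * ?D b c * w i c) = 0" .
  qed
  then show ?thesis by simp
qed

end

section \<open>Decomposition in the case of equality\<close>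

text \<open>The amplitude at (\<open>a\<close>, \<open>b\<close>) of the vector on A and B that
  \<open>V\<close> makes from the basis vector number \<open>k\<close> of L tensored with
  \<psi>.\<close>

definition tensor_embed ::
    "nat \<Rightarrow> nat \<Rightarrow> complex mat \<Rightarrow> complex vec \<Rightarrow> nat \<Rightarrow> nat \<Rightarrow> nat \<Rightarrow> complex" where
  "tensor_embed dR dB V \<psi> k a b = (\<Sum>j<dR. V $$ (a, k * dR + j) * \<psi> $ (j * dB + b))"

lemma ket_bra_carrier: "\<psi> \<in> carrier_vec n \<Longrightarrow> ket_bra \<psi> \<in> carrier_mat n n"
  by (auto simp: ket_bra_def)

lemma ket_bra_index: "\<psi> \<in> carrier_vec n \<Longrightarrow> i < n \<Longrightarrow> j < n \<Longrightarrow> ket_bra \<psi> $$ (i, j) = \<psi> $ i * cnj (\<psi> $ j)"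
  by (auto simp: ket_bra_def)

text \<open>Rests on the strict associativity of the index convention:
  \<open>k * (dR * dB) + (j * dB + c)\<close> equals \<open>(k * dR + j) * dB + c\<close>, so a
  matrix written for L and R together acts on a vector that groups R with B.\<close>

lemma kron_one_apply:
  assumes V: "V \<in> carrier_mat dA (dL * dR)" and ab: "a < dA" "b < dB" and k: "k < dL"
  shows "(\<Sum>t<dR * dB. kron V (1\<^sub>m dB) $$ (a * dB + b, k * (dR * dB) + t) * \<psi> $ t) = tensor_embed dR dB V \<psi> k a b"
proof -
  have "(\<Sum>t<dR * dB. kron V (1\<^sub>m dB) $$ (a * dB + b, k * (dR * dB) + t) * \<psi> $ t) =
    (\<Sum>j<dR. \<Sum>c<dB. kron V (1\<^sub>m dB) $$ (a * dB + b, (k * dR + j) * dB + c) * \<psi> $ (j * dB + c))"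
    unfolding sum_prod_index by (simp only: distrib_right mult.assoc add.assoc)
  also have "\<dots> = (\<Sum>j<dR. V $$ (a, k * dR + j) * (\<Sum>c<dB. (if b = c then 1 else 0) * \<psi> $ (j * dB + c)))"
    unfolding sum_distrib_left
  proof (intro sum.cong refl)
    fix j c assume "j \<in> {..<dR}" "c \<in> {..<dB}"
    then have "k * dR + j < dL * dR" "c < dB" using k prod_index_less by auto
    then show "kron V (1\<^sub>m dB) $$ (a * dB + b, (k * dR + j) * dB + c) * \<psi> $ (j * dB + c) =
      V $$ (a, k * dR + j) * ((if b = c then 1 else 0) * \<psi> $ (j * dB + c))"
      using kron_index[OF V one_carrier_mat ab] ab by (simp add: mult.assoc)
  qed
  also have "\<dots> = tensor_embed dR dB V \<psi> k a b"
    unfolding tensor_embed_def using ab by (simp only: sum_delta_lessThan)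
  finally show ?thesis .
qed

text \<open>Replaces the product of three large matrices by a combination of the vectors
  \<open>tensor_embed dR dB V \<psi> k\<close>. For diagonal \<sigma> this has exactly the shape of
  an ensemble.\<close>

lemma state_times_pure_index:
  assumes V: "V \<in> carrier_mat dA (dL * dR)" and \<sigma>: "\<sigma> \<in> carrier_mat dL dL"
    and \<psi>: "\<psi> \<in> carrier_vec (dR * dB)"
    and ab: "a < dA" "b < dB" "a' < dA" "b' < dB"
  shows "(kron V (1\<^sub>m dB) * kron \<sigma> (ket_bra \<psi>) * mat_adjoint (kron V (1\<^sub>m dB))) $$ (a * dB + b, a' * dB + b') =
    (\<Sum>k<dL. \<Sum>k'<dL. \<sigma> $$ (k, k') * tensor_embed dR dB V \<psi> k a b * cnj (tensor_embed dR dB V \<psi> k' a' b'))"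
proof -
  define K where "K = kron V (1\<^sub>m dB)"
  define S where "S = kron \<sigma> (ket_bra \<psi>)"
  let ?n = "dL * (dR * dB)"
  have K: "K \<in> carrier_mat (dA * dB) ?n"
    using kron_carrier[OF V one_carrier_mat, of dB] by (simp add: K_def mult.assoc)
  have S: "S \<in> carrier_mat ?n ?n"
    unfolding S_def by (rule kron_carrier[OF \<sigma> ket_bra_carrier[OF \<psi>]])
  have apply_K: "(\<Sum>t<dR * dB. K $$ (a * dB + b, k * (dR * dB) + t) * \<psi> $ t) = tensor_embed dR dB V \<psi> k a b"
    if "a < dA" "b < dB" "k < dL" for a b k
    unfolding K_def by (rule kron_one_apply[OF V that])
  let ?x = "a * dB + b" and ?y = "a' * dB + b'"
  have x: "?x < dA * dB" "?y < dA * dB" using ab prod_index_less by auto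
  have KS: "(K * S) $$ (?x, k' * (dR * dB) + t') =
      (\<Sum>k<dL. \<sigma> $$ (k, k') * tensor_embed dR dB V \<psi> k a b) * cnj (\<psi> $ t')"
    if "k' < dL" "t' < dR * dB" for k' t'
  proof -
    have "(K * S) $$ (?x, k' * (dR * dB) + t') = (\<Sum>p<?n. K $$ (?x, p) * S $$ (p, k' * (dR * dB) + t'))"
      by (rule mat_mult_index[OF K S x(1) prod_index_less[OF that]])
    also have "\<dots> = (\<Sum>k<dL. \<Sum>t<dR * dB. K $$ (?x, k * (dR * dB) + t) * S $$ (k * (dR * dB) + t, k' * (dR * dB) + t'))"
      by (rule sum_prod_index)
    also have "\<dots> = (\<Sum>k<dL. \<sigma> $$ (k, k') * cnj (\<psi> $ t') * (\<Sum>t<dR * dB. K $$ (?x, k * (dR * dB) + t) * \<psi> $ t))"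
      unfolding sum_distrib_left
    proof (intro sum.cong refl)
      fix k t assume kt: "k \<in> {..<dL}" "t \<in> {..<dR * dB}"
      have "S $$ (k * (dR * dB) + t, k' * (dR * dB) + t') = \<sigma> $$ (k, k') * (\<psi> $ t * cnj (\<psi> $ t'))"
        unfolding S_def using kt that
        by (subst kron_index[OF \<sigma> ket_bra_carrier[OF \<psi>]]) (auto simp: ket_bra_index[OF \<psi>])
      then show "K $$ (?x, k * (dR * dB) + t) * S $$ (k * (dR * dB) + t, k' * (dR * dB) + t') =
        \<sigma> $$ (k, k') * cnj (\<psi> $ t') * (K $$ (?x, k * (dR * dB) + t) * \<psi> $ t)"
        by (simp only: mult_ac)
    qed
    also have "\<dots> = (\<Sum>k<dL. \<sigma> $$ (k, k') * cnj (\<psi> $ t') * tensor_embed dR dB V \<psi> k a b)"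
      using apply_K[OF ab(1,2)] by simp
    finally show ?thesis by (simp add: sum_distrib_left mult_ac)
  qed
  have "(K * S * mat_adjoint K) $$ (?x, ?y) = (\<Sum>q<?n. (K * S) $$ (?x, q) * mat_adjoint K $$ (q, ?y))"
    by (rule mat_mult_index[OF mult_carrier_mat[OF K S] mat_adjoint_carrier[OF K] x])
  also have "\<dots> = (\<Sum>k'<dL. \<Sum>t'<dR * dB. (K * S) $$ (?x, k' * (dR * dB) + t') * mat_adjoint K $$ (k' * (dR * dB) + t', ?y))"
    by (rule sum_prod_index)
  also have "\<dots> = (\<Sum>k'<dL. (\<Sum>k<dL. \<sigma> $$ (k, k') * tensor_embed dR dB V \<psi> k a b) *
      cnj (\<Sum>t'<dR * dB. K $$ (?y, k' * (dR * dB) + t') * \<psi> $ t'))"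
    unfolding cnj_sum sum_distrib_left
  proof (intro sum.cong refl)
    fix k t assume "k \<in> {..<dL}" "t \<in> {..<dR * dB}"
    then have kt: "k < dL" "t < dR * dB" "k * (dR * dB) + t < ?n" using prod_index_less by auto
    have "mat_adjoint K $$ (k * (dR * dB) + t, ?y) = cnj (K $$ (?y, k * (dR * dB) + t))"
      using K kt x by simp
    then show "(K * S) $$ (?x, k * (dR * dB) + t) * mat_adjoint K $$ (k * (dR * dB) + t, ?y) =
      (\<Sum>j<dL. \<sigma> $$ (j, k) * tensor_embed dR dB V \<psi> j a b) * cnj (K $$ (?y, k * (dR * dB) + t) * \<psi> $ t)"
      unfolding KS[OF kt(1,2)] by simp
  qed
  also have "\<dots> = (\<Sum>k'<dL. \<Sum>k<dL. \<sigma> $$ (k, k') * tensor_embed dR dB V \<psi> k a b * cnj (tensor_embed dR dB V \<psi> k' a' b'))"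
    using apply_K[OF ab(3,4)] by (simp add: sum_distrib_right)
  finally show ?thesis unfolding K_def S_def by (subst sum.swap)
qed

lemma isometry_columns:
  assumes V: "V \<in> carrier_mat dA n" and iso: "isometry_mat V" and xy: "x < n" "y < n"
  shows "cip dA (\<lambda>a. V $$ (a, x)) (\<lambda>a. V $$ (a, y)) = (if x = y then 1 else 0)"
proof -
  have "(mat_adjoint V * V) $$ (y, x) = cip dA (\<lambda>a. V $$ (a, x)) (\<lambda>a. V $$ (a, y))"
    using xy V by (subst mat_mult_index[of _ n dA _ n]) (auto simp: cip_def mult.commute intro!: sum.cong)
  then show ?thesis using iso V xy by (auto simp: isometry_mat_def simp del: index_mult_mat(1))
qed

lemma prod_index_eq_iff: "j < n \<Longrightarrow> j' < n \<Longrightarrow> k * n + j = k' * n + j' \<longleftrightarrow> k = k' \<and> j = (j'::nat)"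
  by (metis div_mult_self3 mod_mult_self3 add.right_neutral div_less mod_less add.commute less_nat_zero_code)

lemma mat_eq_prod_indexI:
  assumes "X \<in> carrier_mat (m * n) (m * n)" "Y \<in> carrier_mat (m * n) (m * n)"
    and eq: "\<And>a b a' b'. a < m \<Longrightarrow> b < n \<Longrightarrow> a' < m \<Longrightarrow> b' < n \<Longrightarrow>
      X $$ (a * n + b, a' * n + b') = Y $$ (a * n + b, a' * n + b')"
  shows "X = Y"
proof (rule eq_matI)
  fix i j assume "i < dim_row Y" "j < dim_col Y"
  then have ij: "i < m * n" "j < m * n" using assms by auto
  then have "0 < n" by (cases n) auto
  then have "i div n < m" "i mod n < n" "j div n < m" "j mod n < n"
    using ij by (auto simp: less_mult_imp_div_less)
  from eq[OF this] show "X $$ (i, j) = Y $$ (i, j)" by simp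
qed (use assms in auto)

context
  fixes dA dB r :: nat and \<rho> :: "complex mat" and l :: "nat \<Rightarrow> real" and M :: "nat \<Rightarrow> nat \<Rightarrow> nat \<Rightarrow> complex"
  assumes \<rho>: "\<rho> \<in> carrier_mat (dA * dB) (dA * dB)" and ens: "ensemble dA dB \<rho> r l M"
begin

text \<open>
  The hypothesis says that the state on B and the purifying system is a product. Slicing along an
  eigenbasis w of the state on B gives pairwise orthogonal vectors \<open>g k j\<close> on A; normalized, they are
  the columns of V.
\<close>

lemma correlation_free_decomposition:
  assumes corr: "\<And>k j b c. k < r \<Longrightarrow> j < r \<Longrightarrow> b < dB \<Longrightarrow> c < dB \<Longrightarrow>
    (\<Sum>a<dA. M k a b * cnj (M j a c)) = (if k = j then ptrace_A dA dB \<rho> $$ (b, c) else 0)"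
  shows "\<exists>dL dR V. subspace_tensor_decomposition dA dL dR V \<and> state_times_pure dL dR dB V \<rho>"
proof -
  note facts = ensemble_facts[OF \<rho> ens]
  let ?R = "ptrace_A dA dB \<rho>"
  have R: "?R \<in> carrier_mat dB dB" by (simp add: ptrace_A_def)
  have r: "0 < r" using facts(2) by (cases r) auto
  \<comment> \<open>By \<open>corr\<close> with both indices 0, the vector \<open>M 0\<close> alone
    already has the reduced state \<open>?R\<close>, which is therefore a Gram sum over
    \<open>a\<close>.\<close>
  have "psd_mat dB ?R"
    by (rule psd_mat_gram[OF R, of "M 0" "{..<dA}"]) (use corr[OF r r] in auto)
  then obtain w m s where es: "psd_eigensystem dB (\<lambda>b c. ?R $$ (b, c)) w m s"
    by (rule psd_spectral)
  then have es': "eigensystem dB (\<lambda>b c. ?R $$ (b, c)) w m" and s: "s \<le> dB"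
    and m_pos: "\<And>j. j < s \<Longrightarrow> 0 < m j" and m_zero: "\<And>j. j < dB \<Longrightarrow> s \<le> j \<Longrightarrow> m j = 0"
    by (auto simp: psd_eigensystem_def)
  note w = eigensystem_onb[OF es']
  define g where "g k j a = cip dB (M k a) (w j)" for k j a
  have g_orth: "cip dA (g k j) (g k' j') = (if k = k' \<and> j = j' then complex_of_real (m j) else 0)"
    if "k < r" "k' < r" "j < dB" "j' < dB" for k k' j j'
  proof -
    have "cip dA (g k j) (g k' j') =
      (\<Sum>b<dB. \<Sum>c<dB. cnj (w j b) * (if k = k' then ?R $$ (b, c) else 0) * w j' c)"
      unfolding g_def cip_slices by (intro sum.cong refl) (use corr that in simp)
    then show ?thesis
      using eigensystem_form[OF es' that(3,4)] by (cases "k = k'") auto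
  qed
  have g_zero: "g k j a = 0" if "k < r" "j < dB" "s \<le> j" "a < dA" for k j a
  proof -
    have "complex_of_real (\<Sum>a<dA. (cmod (g k j a))\<^sup>2) = complex_of_real (m j)"
      using g_orth[of k k j j] that unfolding cip_self by simp
    then have "(\<Sum>a<dA. (cmod (g k j a))\<^sup>2) = 0" using m_zero that of_real_eq_iff by metis
    then show ?thesis using that by (simp add: sum_nonneg_eq_0_iff)
  qed
  \<comment> \<open>Slices along kernel vectors of the state on B vanish, so \<open>s\<close>
    vectors suffice. Hence R receives the dimension \<open>s\<close>, the rank of that
    state.\<close>
  have M_expand: "M k a b = (\<Sum>j<s. g k j a * w j b)" if "k < r" "a < dA" "b < dB" for k a b
  proof -
    have "M k a b = (\<Sum>j<dB. g k j a * w j b)" unfolding g_def using onb_expand[OF w that(3)] ..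
    also have "\<dots> = (\<Sum>j<s. g k j a * w j b)"
      by (rule sum.mono_neutral_right) (use s g_zero that in auto)
    finally show ?thesis .
  qed
  have m_sum: "(\<Sum>j<s. m j) = 1"
  proof -
    have "1 = (\<Sum>a<dA. \<Sum>j<dB. g 0 j a * cnj (g 0 j a))"
      unfolding g_def parseval[OF w] using facts(3)[OF r r] by simp
    also have "\<dots> = (\<Sum>j<dB. cip dA (g 0 j) (g 0 j))" unfolding cip_def by (rule sum.swap)
    also have "\<dots> = (\<Sum>j<dB. complex_of_real (m j))" using g_orth r by simp
    also have "\<dots> = (\<Sum>j<s. complex_of_real (m j))"
      by (rule sum.mono_neutral_right) (use s m_zero in auto)
    finally have "complex_of_real (\<Sum>j<s. m j) = 1" by simp
    then show ?thesis using of_real_eq_1_iff by blast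
  qed
  have sq: "complex_of_real (sqrt (m j)) * complex_of_real (sqrt (m j)) = complex_of_real (m j)"
    if "j < s" for j
    using m_pos[OF that] unfolding of_real_mult[symmetric] by simp
  have sq0: "complex_of_real (sqrt (m j)) \<noteq> 0" if "j < s" for j using m_pos[OF that] by simp
  \<comment> \<open>L carries the ensemble index, with spectrum \<open>l\<close>, and \<psi> is the
    Schmidt purification on R of the state on B. \<open>V\<close> sends the basis vector
    \<open>k * s + j\<close> to the normalized slice, so the factors \<open>sqrt (m j)\<close> of
    \<open>V\<close> and \<psi> cancel and \<open>tensor_embed\<close> returns
    \<open>M k\<close>.\<close>
  define V where "V = mat dA (r * s) (\<lambda>(a, x). g (x div s) (x mod s) a / complex_of_real (sqrt (m (x mod s))))"
  define \<sigma> where "\<sigma> = mat_diag r (\<lambda>k. complex_of_real (l k))"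
  define \<psi> where "\<psi> = vec (s * dB) (\<lambda>x. complex_of_real (sqrt (m (x div dB))) * w (x div dB) (x mod dB))"
  have V: "V \<in> carrier_mat dA (r * s)" by (simp add: V_def)
  have \<sigma>: "\<sigma> \<in> carrier_mat r r" by (simp add: \<sigma>_def)
  have \<psi>: "\<psi> \<in> carrier_vec (s * dB)" by (simp add: \<psi>_def)
  have V_index: "V $$ (a, k * s + j) = g k j a / complex_of_real (sqrt (m j))"
    if "a < dA" "k < r" "j < s" for a k j
    using that prod_index_less[of k r j s] by (simp add: V_def)
  have \<psi>_index: "\<psi> $ (j * dB + b) = complex_of_real (sqrt (m j)) * w j b" if "j < s" "b < dB" for j b
    using that prod_index_less[of j s b dB] by (simp add: \<psi>_def)
  have "isometry_mat V"
    unfolding isometry_mat_def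
  proof (rule mat_eq_prod_indexI[of _ r s])
    fix k j k' j' assume kj: "k < r" "j < s" "k' < r" "j' < s"
    have "(mat_adjoint V * V) $$ (k * s + j, k' * s + j') =
      cip dA (\<lambda>a. V $$ (a, k' * s + j')) (\<lambda>a. V $$ (a, k * s + j))"
      using V prod_index_less kj
      by (subst mat_mult_index[of _ "r * s" dA _ "r * s"]) (auto simp: cip_def mult.commute intro!: sum.cong)
    also have "\<dots> = cip dA (\<lambda>a. (1 / complex_of_real (sqrt (m j'))) * g k' j' a) (\<lambda>a. (1 / complex_of_real (sqrt (m j))) * g k j a)"
      by (rule cip_cong) (use V_index kj in auto)
    also have "\<dots> = (if k = k' \<and> j = j' then 1 else 0)"
      unfolding cip_scale using g_orth[of k' k j' j] kj s sq[OF kj(2)] sq0[OF kj(2)]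
      by (auto simp: field_simps)
    also have "\<dots> = 1\<^sub>m (dim_col V) $$ (k * s + j, k' * s + j')"
      using V prod_index_less kj by (auto simp: prod_index_eq_iff)
    finally show "(mat_adjoint V * V) $$ (k * s + j, k' * s + j') = 1\<^sub>m (dim_col V) $$ (k * s + j, k' * s + j')" .
  qed (use V in auto)
  moreover have "density_mat r \<sigma>"
  proof -
    have "psd_mat r \<sigma>"
    proof (rule psd_mat_gram[OF \<sigma>, of "\<lambda>k a. (if a = k then 1 else 0) * complex_of_real (sqrt (l k))" "{..<r}"])
      fix a b assume ab: "a < r" "b < r"
      have "(\<Sum>k<r. (if a = k then 1 else 0) * complex_of_real (sqrt (l k)) * cnj ((if b = k then 1 else 0) * complex_of_real (sqrt (l k)))) =
        (\<Sum>k<r. (if a = k then 1 else 0) * ((if b = k then 1 else 0) * complex_of_real (sqrt (l k) * sqrt (l k))))"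
        by (intro sum.cong refl) (auto simp del: real_sqrt_mult_self)
      also have "\<dots> = (if b = a then 1 else 0) * complex_of_real (sqrt (l a) * sqrt (l a))"
        using ab by (simp only: sum_delta_lessThan)
      also have "\<dots> = \<sigma> $$ (a, b)"
        using ab facts(1)[OF ab(1)] by (simp add: \<sigma>_def mat_diag_def del: of_real_mult)
      finally show "\<sigma> $$ (a, b) = (\<Sum>k<r. (if a = k then 1 else 0) * complex_of_real (sqrt (l k)) * cnj ((if b = k then 1 else 0) * complex_of_real (sqrt (l k))))" ..
    qed
    moreover have "mat_trace \<sigma> = complex_of_real (\<Sum>k<r. l k)" by (simp add: mat_trace_def \<sigma>_def mat_diag_def)
    ultimately show ?thesis using facts(2) by (simp add: density_mat_def)
  qed
  moreover have "unit_vector (s * dB) \<psi>"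
  proof -
    have "\<psi> \<bullet>c \<psi> = (\<Sum>x<s * dB. \<psi> $ x * cnj (\<psi> $ x))"
      by (simp add: scalar_prod_def \<psi>_def lessThan_atLeast0)
    also have "\<dots> = (\<Sum>j<s. complex_of_real (m j) * cip dB (w j) (w j))"
      unfolding sum_prod_index cip_def sum_distrib_left
      by (intro sum.cong refl) (simp only: \<psi>_index sq[symmetric] lessThan_iff complex_cnj_mult complex_cnj_complex_of_real mult_ac)
    also have "\<dots> = complex_of_real (\<Sum>j<s. m j)" using onb_orthonormal[OF w] s by simp
    finally show ?thesis using m_sum \<psi> by (simp add: unit_vector_def)
  qed
  moreover have "\<rho> = kron V (1\<^sub>m dB) * kron \<sigma> (ket_bra \<psi>) * mat_adjoint (kron V (1\<^sub>m dB))"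
  proof (rule mat_eq_prod_indexI[OF \<rho>])
    have K: "kron V (1\<^sub>m dB) \<in> carrier_mat (dA * dB) (r * (s * dB))"
      using kron_carrier[OF V one_carrier_mat, of dB] by (simp add: mult.assoc)
    show "kron V (1\<^sub>m dB) * kron \<sigma> (ket_bra \<psi>) * mat_adjoint (kron V (1\<^sub>m dB)) \<in> carrier_mat (dA * dB) (dA * dB)"
      using mult_carrier_mat[OF mult_carrier_mat[OF K kron_carrier[OF \<sigma> ket_bra_carrier[OF \<psi>]]] mat_adjoint_carrier[OF K]] .
    fix a b a' b' assume ab: "a < dA" "b < dB" "a' < dA" "b' < dB"
    have emb: "tensor_embed s dB V \<psi> k a b = M k a b" if "k < r" "a < dA" "b < dB" for k a b
      unfolding tensor_embed_def M_expand[OF that]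
      by (intro sum.cong refl) (use that sq0 in \<open>simp add: V_index \<psi>_index\<close>)
    have "(\<Sum>k<r. \<Sum>k'<r. \<sigma> $$ (k, k') * tensor_embed s dB V \<psi> k a b * cnj (tensor_embed s dB V \<psi> k' a' b')) =
      (\<Sum>k<r. \<Sum>k'<r. (if k = k' then 1 else 0) * (complex_of_real (l k) * M k a b * cnj (M k' a' b')))"
      by (intro sum.cong refl) (use ab emb in \<open>auto simp: \<sigma>_def mat_diag_def\<close>)
    also have "\<dots> = (\<Sum>k<r. complex_of_real (l k) * M k a b * cnj (M k a' b'))"
      by (intro sum.cong refl) (simp only: sum_delta_lessThan lessThan_iff)
    finally show "\<rho> $$ (a * dB + b, a' * dB + b') =
      (kron V (1\<^sub>m dB) * kron \<sigma> (ket_bra \<psi>) * mat_adjoint (kron V (1\<^sub>m dB))) $$ (a * dB + b, a' * dB + b')"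
      unfolding state_times_pure_index[OF V \<sigma> \<psi> ab] facts(4)[OF ab] ..
  qed
  ultimately show ?thesis
    using V unfolding subspace_tensor_decomposition_def state_times_pure_def by blast
qed

section \<open>Towards the converse: entropy and total probability for an arbitrary ensemble\<close>

lemma ensemble_entropy: "entropy \<rho> = (\<Sum>k<r. eta (l k))"
proof (rule entropy_orthogonal_sum[OF \<rho>])
  note facts = ensemble_facts[OF \<rho> ens]
  let ?y = "\<lambda>k x. complex_of_real (sqrt (l k)) * M k (x div dB) (x mod dB)"
  have sq: "complex_of_real (sqrt (l k)) * complex_of_real (sqrt (l k)) = complex_of_real (l k)" if "k < r" for k
    using facts(1)[OF that] unfolding of_real_mult[symmetric] by simp
  fix x y assume xy: "x < dA * dB" "y < dA * dB"
  then have "0 < dB" by (cases dB) auto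
  then have "x div dB < dA" "x mod dB < dB" "y div dB < dA" "y mod dB < dB"
    using xy by (auto simp: less_mult_imp_div_less)
  from facts(4)[OF this]
  have "\<rho> $$ (x, y) = (\<Sum>k<r. complex_of_real (l k) * M k (x div dB) (x mod dB) * cnj (M k (y div dB) (y mod dB)))"
    by simp
  also have "\<dots> = (\<Sum>k<r. ?y k x * cnj (?y k y))"
    by (intro sum.cong refl) (simp only: sq[symmetric] lessThan_iff complex_cnj_mult complex_cnj_complex_of_real mult_ac)
  finally show "\<rho> $$ (x, y) = (\<Sum>k<r. ?y k x * cnj (?y k y))" .
next
  note facts = ensemble_facts[OF \<rho> ens]
  fix k j assume kj: "k \<in> {..<r}" "j \<in> {..<r}"
  have "cip (dA * dB) (\<lambda>x. M k (x div dB) (x mod dB)) (\<lambda>x. M j (x div dB) (x mod dB)) =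
    (\<Sum>a<dA. cip dB (M k a) (M j a))"
    unfolding cip_def sum_prod_index by (intro sum.cong refl) simp
  then show "cip (dA * dB) (\<lambda>x. complex_of_real (sqrt (l k)) * M k (x div dB) (x mod dB))
      (\<lambda>x. complex_of_real (sqrt (l j)) * M j (x div dB) (x mod dB)) =
    (if k = j then complex_of_real (l j) else 0)"
    unfolding cip_scale using facts(1,3) kj
    by (auto simp: of_real_mult[symmetric] less_imp_le simp del: of_real_mult)
qed simp

lemma outcome_prob_sum:
  assumes "povm dB n E"
  shows "(\<Sum>i\<in>{i. i < n \<and> outcome_prob dA \<rho> (E i) \<noteq> 0}. outcome_prob dA \<rho> (E i)) = 1"
proof -
  note facts = ensemble_facts[OF \<rho> ens]
  have E: "E i \<in> carrier_mat dB dB" if "i < n" for i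
    using assms that by (simp add: povm_def psd_mat_def)
  have E_sum: "(\<Sum>i<n. E i $$ (b, c)) = (if b = c then 1 else 0)" if "b < dB" "c < dB" for b c
  proof -
    have "mat dB dB (\<lambda>(r, c). \<Sum>i<n. E i $$ (r, c)) $$ (b, c) = 1\<^sub>m dB $$ (b, c)"
      using assms by (simp only: povm_def)
    then show ?thesis using that by simp
  qed
  have "complex_of_real (\<Sum>i<n. outcome_prob dA \<rho> (E i)) = complex_of_real (Re (\<Sum>i<n. mat_trace (post_op dA dB \<rho> (E i))))"
    using outcome_prob_eq[OF \<rho> E] by simp
  also have "(\<Sum>i<n. mat_trace (post_op dA dB \<rho> (E i))) =
    (\<Sum>i<n. \<Sum>a<dA. \<Sum>b<dB. \<Sum>c<dB. E i $$ (b, c) * \<rho> $$ (a * dB + c, a * dB + b))"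
    by (simp add: mat_trace_def post_op_index[OF \<rho> E])
  also have "\<dots> = (\<Sum>a<dA. \<Sum>b<dB. \<Sum>i<n. \<Sum>c<dB. E i $$ (b, c) * \<rho> $$ (a * dB + c, a * dB + b))"
    by (rule sum_rotate[symmetric])
  also have "\<dots> = (\<Sum>a<dA. \<Sum>b<dB. \<Sum>c<dB. (if b = c then 1 else 0) * \<rho> $$ (a * dB + c, a * dB + b))"
  proof (rule sum.cong[OF refl], rule sum.cong[OF refl])
    fix a b assume "b \<in> {..<dB}"
    then show "(\<Sum>i<n. \<Sum>c<dB. E i $$ (b, c) * \<rho> $$ (a * dB + c, a * dB + b)) =
      (\<Sum>c<dB. (if b = c then 1 else 0) * \<rho> $$ (a * dB + c, a * dB + b))"
      by (subst sum.swap) (simp add: E_sum[symmetric] sum_distrib_right)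
  qed
  also have "\<dots> = (\<Sum>a<dA. \<Sum>b<dB. \<rho> $$ (a * dB + b, a * dB + b))"
    by (intro sum.cong refl) (simp only: sum_delta_lessThan lessThan_iff)
  also have "\<dots> = (\<Sum>a<dA. \<Sum>b<dB. \<Sum>k<r. complex_of_real (l k) * (M k a b * cnj (M k a b)))"
    by (intro sum.cong refl) (simp add: facts(4) mult.assoc)
  also have "\<dots> = (\<Sum>k<r. complex_of_real (l k) * (\<Sum>a<dA. cip dB (M k a) (M k a)))"
    unfolding cip_def by (subst sum_rotate) (simp only: sum_distrib_left)
  also have "\<dots> = complex_of_real (\<Sum>k<r. l k)" using facts(3) by simp
  finally have "(\<Sum>i<n. outcome_prob dA \<rho> (E i)) = 1" using facts(2) by (simp only: Re_complex_of_real of_real_eq_iff)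
  moreover have "(\<Sum>i\<in>{i. i < n \<and> outcome_prob dA \<rho> (E i) \<noteq> 0}. outcome_prob dA \<rho> (E i)) =
    (\<Sum>i<n. outcome_prob dA \<rho> (E i))"
    by (rule sum.mono_neutral_left) auto
  ultimately show ?thesis by simp
qed

end

text \<open>\<open>X\<close> is the image of diag(d) tensor \<tau> under the isometry with columns
  \<open>W i j\<close>. Rotating \<open>j\<close> into an eigenbasis of \<tau> gives orthogonal
  vectors with squared norms \<open>d i * c k\<close>; the entropy splits by
  \<open>eta_mult\<close>, as both families of weights sum to one.\<close>

lemma entropy_tensor:
  fixes W :: "nat \<Rightarrow> nat \<Rightarrow> nat \<Rightarrow> complex" and d :: "nat \<Rightarrow> real"
  assumes X: "X \<in> carrier_mat n n" and \<tau>: "density_mat m \<tau>"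
    and X_eq: "\<And>a a'. a < n \<Longrightarrow> a' < n \<Longrightarrow> X $$ (a, a') =
      (\<Sum>i<t. complex_of_real (d i) * (\<Sum>j<m. \<Sum>j'<m. W i j a * cnj (W i j' a') * \<tau> $$ (j, j')))"
    and W: "\<And>i i' j j'. i < t \<Longrightarrow> i' < t \<Longrightarrow> j < m \<Longrightarrow> j' < m \<Longrightarrow>
      cip n (W i j) (W i' j') = (if i = i' \<and> j = j' then 1 else 0)"
    and d_pos: "\<And>i. i < t \<Longrightarrow> 0 < d i" and d_sum: "(\<Sum>i<t. d i) = 1"
  shows "entropy X = (\<Sum>i<t. eta (d i)) + entropy \<tau>"
proof -
  obtain f c q where es: "psd_eigensystem m (\<lambda>j j'. \<tau> $$ (j, j')) f c q"
    and c_sum: "(\<Sum>k<q. c k) = 1" and ent: "entropy \<tau> = (\<Sum>k<q. eta (c k))"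
    using \<tau> by (rule density_spectral)
  have f: "onb m f" and q: "q \<le> m" and c_pos: "\<And>k. k < q \<Longrightarrow> 0 < c k"
    using es by (auto simp: psd_eigensystem_def eigensystem_def)
  define z where "z i k a = (\<Sum>j<m. f k j * W i j a)" for i k a
  define y where "y = (\<lambda>(i, k) a. complex_of_real (sqrt (d i * c k)) * z i k a)"
  let ?J = "{..<t} \<times> {..<q}"
  have sq: "complex_of_real (sqrt (d i * c k)) * complex_of_real (sqrt (d i * c k)) = complex_of_real (d i * c k)"
    if "i < t" "k < q" for i k
    using d_pos[OF that(1)] c_pos[OF that(2)] unfolding of_real_mult[symmetric] by simp
  have z_orth: "cip n (z i k) (z i' k') = (if i = i' \<and> k = k' then 1 else 0)"
    if ii: "i < t" "i' < t" and kk: "k < q" "k' < q" for i i' k k'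
  proof -
    have "cip n (z i k) (z i' k') = (\<Sum>j<m. f k j * (\<Sum>j'<m. cnj (f k' j') * cip n (W i j) (W i' j')))"
      unfolding z_def cip_sum_left cip_sum_right by (rule refl)
    also have "\<dots> = (\<Sum>j<m. f k j * (\<Sum>j'<m. (if j = j' then 1 else 0) * (cnj (f k' j') * (if i = i' then 1 else 0))))"
      by (rule sum.cong[OF refl], rule arg_cong2[where f = "(*)", OF refl], rule sum.cong[OF refl]) (use W ii in auto)
    also have "\<dots> = (\<Sum>j<m. f k j * (cnj (f k' j) * (if i = i' then 1 else 0)))"
      by (intro sum.cong refl) (simp only: sum_delta_lessThan lessThan_iff)
    also have "\<dots> = cip m (f k) (f k') * (if i = i' then 1 else 0)"
      unfolding cip_def sum_distrib_right by (simp only: mult.assoc)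
    finally show ?thesis using onb_orthonormal[OF f, of k k'] kk q by simp
  qed
  have "entropy X = (\<Sum>x\<in>?J. eta (case x of (i, k) \<Rightarrow> d i * c k))"
  proof (rule entropy_orthogonal_sum[OF X])
    fix a a' assume a: "a < n" "a' < n"
    have "X $$ (a, a') = (\<Sum>i<t. \<Sum>k<q. complex_of_real (d i * c k) * (z i k a * cnj (z i k a')))"
      unfolding X_eq[OF a]
    proof (rule sum.cong[OF refl])
      fix i
      have "(\<Sum>j<m. \<Sum>j'<m. W i j a * cnj (W i j' a') * \<tau> $$ (j, j')) =
        (\<Sum>j<m. \<Sum>j'<m. \<Sum>k<q. complex_of_real (c k) * ((f k j * W i j a) * (cnj (f k j') * cnj (W i j' a'))))"
        by (intro sum.cong refl) (simp add: psd_eigensystem_eq[OF es] sum_distrib_left mult_ac)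
      also have "\<dots> = (\<Sum>k<q. complex_of_real (c k) * (z i k a * cnj (z i k a')))"
        unfolding z_def cnj_sum complex_cnj_mult sum_product
        by (subst sum_rotate) (simp only: sum_distrib_left)
      finally show "complex_of_real (d i) * (\<Sum>j<m. \<Sum>j'<m. W i j a * cnj (W i j' a') * \<tau> $$ (j, j')) =
        (\<Sum>k<q. complex_of_real (d i * c k) * (z i k a * cnj (z i k a')))"
        by (simp only: sum_distrib_left of_real_mult mult.assoc)
    qed
    also have "\<dots> = (\<Sum>(i, k)\<in>?J. complex_of_real (d i * c k) * (z i k a * cnj (z i k a')))"
      by (rule sum.cartesian_product)
    also have "\<dots> = (\<Sum>x\<in>?J. y x a * cnj (y x a'))"
    proof (rule sum.cong[OF refl], clarsimp simp del: of_real_mult)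
      fix i k assume "i < t" "k < q"
      moreover have "y (i, k) a * cnj (y (i, k) a') =
        (complex_of_real (sqrt (d i * c k)) * complex_of_real (sqrt (d i * c k))) * (z i k a * cnj (z i k a'))"
        unfolding y_def by (simp only: prod.case complex_cnj_mult complex_cnj_complex_of_real mult_ac)
      ultimately show "complex_of_real (d i * c k) * (z i k a * cnj (z i k a')) = y (i, k) a * cnj (y (i, k) a')"
        using sq[of i k] by simp
    qed
    finally show "X $$ (a, a') = (\<Sum>x\<in>?J. y x a * cnj (y x a'))" .
  next
    fix x x' assume x: "x \<in> ?J" "x' \<in> ?J"
    obtain i k i' k' where eq: "x = (i, k)" "x' = (i', k')" by (cases x, cases x') auto
    show "cip n (y x) (y x') = (if x = x' then complex_of_real (case x' of (i, k) \<Rightarrow> d i * c k) else 0)"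
      using x z_orth[of i i' k k'] sq[of i k] unfolding y_def eq prod.case cip_scale by auto
  qed simp
  also have "\<dots> = (\<Sum>i<t. \<Sum>k<q. eta (d i * c k))"
    unfolding sum.cartesian_product by (rule sum.cong) auto
  also have "\<dots> = (\<Sum>i<t. \<Sum>k<q. c k * eta (d i) + d i * eta (c k))"
    by (intro sum.cong refl eta_mult) (simp_all add: d_pos c_pos less_imp_le)
  also have "\<dots> = (\<Sum>i<t. eta (d i)) + (\<Sum>k<q. eta (c k))"
    by (simp add: sum.distrib sum_distrib_left[symmetric] sum_distrib_right[symmetric] c_sum d_sum)
  finally show ?thesis using ent by simp
qed

text \<open>Treats all POVMs, as the supremum demands. An effect \<open>F\<close> on B turns \<rho>
  into an isometric image of \<sigma> tensor the state that \<open>F\<close> leaves of \<psi> on R,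
  and it has the same probability for \<rho> as for \<psi>. Since the probabilities sum to one,
  S(AB) is its own average over the outcomes, and the comparison can be made outcome by
  outcome.\<close>

lemma information_gain_state_times_pure:
  assumes \<rho>: "\<rho> \<in> carrier_mat (dA * dB) (dA * dB)"
    and dec: "subspace_tensor_decomposition dA dL dR V" and pure: "state_times_pure dL dR dB V \<rho>"
    and E: "povm dB n E"
  shows "information_gain dA dB \<rho> n E \<le> entropy (ptrace_B dA dB \<rho>) - entropy \<rho>"
proof -
  have V: "V \<in> carrier_mat dA (dL * dR)" and iso: "isometry_mat V"
    using dec by (auto simp: subspace_tensor_decomposition_def)
  obtain \<sigma> \<psi> where \<sigma>: "density_mat dL \<sigma>" and \<psi>_unit: "unit_vector (dR * dB) \<psi>"
    and \<rho>_eq: "\<rho> = kron V (1\<^sub>m dB) * kron \<sigma> (ket_bra \<psi>) * mat_adjoint (kron V (1\<^sub>m dB))"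
    using pure by (auto simp: state_times_pure_def)
  have \<sigma>c: "\<sigma> \<in> carrier_mat dL dL" using \<sigma> by (simp add: density_mat_def psd_mat_def)
  have \<psi>: "\<psi> \<in> carrier_vec (dR * dB)" and \<psi>_norm: "\<psi> \<bullet>c \<psi> = 1"
    using \<psi>_unit by (auto simp: unit_vector_def)
  define \<phi> where "\<phi> j b = \<psi> $ (j * dB + b)" for j b
  have \<phi>_norm: "(\<Sum>j<dR. cip dB (\<phi> j) (\<phi> j)) = 1"
    using \<psi>_norm \<psi> by (simp add: cip_def \<phi>_def scalar_prod_def lessThan_atLeast0[symmetric] sum_prod_index)
  obtain u d t where es: "psd_eigensystem dL (\<lambda>k k'. \<sigma> $$ (k, k')) u d t"
    and d_sum: "(\<Sum>i<t. d i) = 1"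
    using \<sigma> by (rule density_spectral)
  have u: "onb dL u" and t: "t \<le> dL" and d_pos: "\<And>i. i < t \<Longrightarrow> 0 < d i"
    using es by (auto simp: psd_eigensystem_def eigensystem_def)
  \<comment> \<open>The columns of \<open>V\<close> with the index of L rotated into an eigenbasis
    of \<sigma>; they remain orthonormal in the pair (\<open>i\<close>, \<open>j\<close>).\<close>
  define W where "W i j a = (\<Sum>k<dL. u i k * V $$ (a, k * dR + j))" for i j a
  have W_orth: "cip dA (W i j) (W i' j') = (if i = i' \<and> j = j' then 1 else 0)"
    if ii: "i < t" "i' < t" and jj: "j < dR" "j' < dR" for i i' j j'
  proof -
    have "cip dA (W i j) (W i' j') = (\<Sum>k<dL. u i k * (\<Sum>k'<dL. cnj (u i' k') *
        cip dA (\<lambda>a. V $$ (a, k * dR + j)) (\<lambda>a. V $$ (a, k' * dR + j'))))"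
      unfolding W_def cip_sum_left cip_sum_right by (rule refl)
    also have "\<dots> = (\<Sum>k<dL. u i k * (\<Sum>k'<dL. (if k = k' then 1 else 0) * (cnj (u i' k') * (if j = j' then 1 else 0))))"
    proof (rule sum.cong[OF refl], rule arg_cong2[where f = "(*)", OF refl], rule sum.cong[OF refl])
      fix k k' assume "k \<in> {..<dL}" "k' \<in> {..<dL}"
      then show "cnj (u i' k') * cip dA (\<lambda>a. V $$ (a, k * dR + j)) (\<lambda>a. V $$ (a, k' * dR + j')) =
        (if k = k' then 1 else 0) * (cnj (u i' k') * (if j = j' then 1 else 0))"
        using isometry_columns[OF V iso prod_index_less[of k dL j dR] prod_index_less[of k' dL j' dR]] jj
        by (auto simp: prod_index_eq_iff)
    qed
    also have "\<dots> = (\<Sum>k<dL. u i k * (cnj (u i' k) * (if j = j' then 1 else 0)))"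
      by (intro sum.cong refl) (simp only: sum_delta_lessThan lessThan_iff)
    also have "\<dots> = cip dL (u i) (u i') * (if j = j' then 1 else 0)"
      unfolding cip_def sum_distrib_right by (simp only: mult.assoc)
    finally show ?thesis using onb_orthonormal[OF u, of i i'] ii t by simp
  qed
  define Y where "Y i a b = (\<Sum>j<dR. \<phi> j b * W i j a)" for i a b
  have Y_embed: "Y i a b = (\<Sum>k<dL. u i k * tensor_embed dR dB V \<psi> k a b)" for i a b
    unfolding Y_def W_def tensor_embed_def \<phi>_def sum_distrib_left by (subst sum.swap) (simp only: mult_ac)
  \<comment> \<open>This identifies the positive eigenvalues \<open>d\<close> of \<sigma> as the
    weights of an ensemble of \<rho>, so that \<open>ensemble_entropy\<close> yields S(AB) from
    them.\<close>
  have ens: "ensemble dA dB \<rho> t d Y"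
    unfolding ensemble_def
  proof (intro conjI allI impI)
    fix i i' assume ii: "i < t" "i' < t"
    have "(\<Sum>a<dA. cip dB (Y i a) (Y i' a)) = (\<Sum>b<dB. cip dA (\<lambda>a. Y i a b) (\<lambda>a. Y i' a b))"
      unfolding cip_def by (rule sum.swap)
    also have "\<dots> = (\<Sum>b<dB. \<Sum>j<dR. \<phi> j b * (\<Sum>j'<dR. cnj (\<phi> j' b) * cip dA (W i j) (W i' j')))"
      unfolding Y_def cip_sum_left cip_sum_right by (rule refl)
    also have "\<dots> = (\<Sum>b<dB. \<Sum>j<dR. \<phi> j b * (\<Sum>j'<dR. (if j = j' then 1 else 0) * (cnj (\<phi> j' b) * (if i = i' then 1 else 0))))"
      by (rule sum.cong[OF refl],
        rule sum.cong[OF refl], rule arg_cong2[where f = "(*)", OF refl], rule sum.cong[OF refl]) (use W_orth ii in auto)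
    also have "\<dots> = (\<Sum>b<dB. \<Sum>j<dR. \<phi> j b * (cnj (\<phi> j b) * (if i = i' then 1 else 0)))"
      by (rule sum.cong[OF refl], rule sum.cong[OF refl]) (simp only: sum_delta_lessThan lessThan_iff)
    also have "\<dots> = (\<Sum>j<dR. cip dB (\<phi> j) (\<phi> j)) * (if i = i' then 1 else 0)"
      unfolding cip_def sum_distrib_right by (subst sum.swap) (simp only: mult.assoc)
    finally show "(\<Sum>a<dA. cip dB (Y i a) (Y i' a)) = (if i = i' then 1 else 0)"
      unfolding \<phi>_norm by simp
  next
    fix a b a' b' assume ab: "a < dA" "b < dB" "a' < dA" "b' < dB"
    let ?F = "tensor_embed dR dB V \<psi>"
    have "\<rho> $$ (a * dB + b, a' * dB + b') = (\<Sum>k<dL. \<Sum>k'<dL. \<sigma> $$ (k, k') * ?F k a b * cnj (?F k' a' b'))"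
      unfolding \<rho>_eq by (rule state_times_pure_index[OF V \<sigma>c \<psi> ab])
    also have "\<dots> = (\<Sum>k<dL. \<Sum>k'<dL. \<Sum>i<t. complex_of_real (d i) * ((u i k * ?F k a b) * (cnj (u i k') * cnj (?F k' a' b'))))"
      by (intro sum.cong refl) (simp add: psd_eigensystem_eq[OF es] sum_distrib_left sum_distrib_right mult_ac)
    also have "\<dots> = (\<Sum>i<t. complex_of_real (d i) * (Y i a b * cnj (Y i a' b')))"
      unfolding Y_embed cnj_sum complex_cnj_mult sum_product
      by (subst sum_rotate) (simp only: sum_distrib_left)
    finally show "\<rho> $$ (a * dB + b, a' * dB + b') = (\<Sum>i<t. complex_of_real (d i) * Y i a b * cnj (Y i a' b'))"
      by (simp only: mult.assoc)
  qed (use d_pos d_sum in auto)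
  have \<psi>c: "ket_bra \<psi> \<in> carrier_mat (dR * dB) (dR * dB)" using \<psi> by (rule ket_bra_carrier)
  \<comment> \<open>A pure state is an ensemble of one vector of weight 1. The facts on
    post-measurement states then also apply to R and B and make the state left on R a density
    matrix.\<close>
  have \<psi>_ens: "ensemble dR dB (ket_bra \<psi>) 1 (\<lambda>_. 1) (\<lambda>_. \<phi>)"
    unfolding ensemble_def using \<phi>_norm by (auto simp: ket_bra_index[OF \<psi>] prod_index_less \<phi>_def)
  have step: "outcome_prob dA \<rho> F = outcome_prob dR (ket_bra \<psi>) F \<and>
    (outcome_prob dA \<rho> F \<noteq> 0 \<longrightarrow> entropy \<rho> \<le> entropy (post_state dA dB \<rho> F))" if psd: "psd_mat dB F" for F
  proof -
    have F: "F \<in> carrier_mat dB dB" using psd by (simp add: psd_mat_def)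
    let ?T = "post_op dR dB (ket_bra \<psi>) F"
    have T: "?T $$ (j, j') = (\<Sum>b<dB. \<Sum>c<dB. F $$ (b, c) * \<phi> j c * cnj (\<phi> j' b))" if "j < dR" "j' < dR" for j j'
      using post_op_ensemble[OF \<psi>c \<psi>_ens F that] by simp
    have op: "post_op dA dB \<rho> F $$ (a, a') =
      (\<Sum>i<t. complex_of_real (d i) * (\<Sum>j<dR. \<Sum>j'<dR. W i j a * cnj (W i j' a') * ?T $$ (j, j')))"
      if a: "a < dA" "a' < dA" for a a'
      unfolding post_op_ensemble[OF \<rho> ens F a]
    proof (rule sum.cong[OF refl], rule arg_cong2[where f = "(*)", OF refl])
      fix i
      let ?g = "\<lambda>b c j j'. F $$ (b, c) * ((\<phi> j c * W i j a) * (cnj (\<phi> j' b) * cnj (W i j' a')))"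
      have "(\<Sum>b<dB. \<Sum>c<dB. F $$ (b, c) * Y i a c * cnj (Y i a' b)) =
        (\<Sum>b<dB. \<Sum>c<dB. F $$ (b, c) * (Y i a c * cnj (Y i a' b)))"
        by (simp only: mult.assoc)
      also have "\<dots> = (\<Sum>b<dB. \<Sum>c<dB. \<Sum>j<dR. \<Sum>j'<dR. ?g b c j j')"
        unfolding Y_def cnj_sum complex_cnj_mult sum_product by (simp only: sum_distrib_left)
      also have "\<dots> = (\<Sum>j<dR. \<Sum>b<dB. \<Sum>c<dB. \<Sum>j'<dR. ?g b c j j')" by (rule sum_rotate)
      also have "\<dots> = (\<Sum>j<dR. \<Sum>j'<dR. \<Sum>b<dB. \<Sum>c<dB. ?g b c j j')"
        by (rule sum.cong[OF refl], rule sum_rotate)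
      also have "\<dots> = (\<Sum>j<dR. \<Sum>j'<dR. W i j a * cnj (W i j' a') * ?T $$ (j, j'))"
      proof (rule sum.cong[OF refl], rule sum.cong[OF refl])
        fix j j' assume "j \<in> {..<dR}" "j' \<in> {..<dR}"
        then have "?T $$ (j, j') = (\<Sum>b<dB. \<Sum>c<dB. F $$ (b, c) * \<phi> j c * cnj (\<phi> j' b))"
          using T by simp
        then show "(\<Sum>b<dB. \<Sum>c<dB. ?g b c j j') = W i j a * cnj (W i j' a') * ?T $$ (j, j')"
          by (simp add: sum_distrib_left mult_ac)
      qed
      finally show "(\<Sum>b<dB. \<Sum>c<dB. F $$ (b, c) * Y i a c * cnj (Y i a' b)) =
        (\<Sum>j<dR. \<Sum>j'<dR. W i j a * cnj (W i j' a') * ?T $$ (j, j'))" .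
    qed
    have "mat_trace (post_op dA dB \<rho> F) =
      (\<Sum>a<dA. \<Sum>i<t. complex_of_real (d i) * (\<Sum>j<dR. \<Sum>j'<dR. W i j a * cnj (W i j' a) * ?T $$ (j, j')))"
      by (simp add: mat_trace_def op)
    also have "\<dots> = (\<Sum>i<t. complex_of_real (d i) * (\<Sum>a<dA. \<Sum>j<dR. \<Sum>j'<dR. W i j a * cnj (W i j' a) * ?T $$ (j, j')))"
      unfolding sum_distrib_left by (rule sum.swap)
    also have "\<dots> = (\<Sum>i<t. complex_of_real (d i) * mat_trace ?T)"
    proof (rule sum.cong[OF refl], rule arg_cong2[where f = "(*)", OF refl])
      fix i assume i: "i \<in> {..<t}"
      have "(\<Sum>a<dA. \<Sum>j<dR. \<Sum>j'<dR. W i j a * cnj (W i j' a) * ?T $$ (j, j')) =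
        (\<Sum>j<dR. \<Sum>j'<dR. cip dA (W i j) (W i j') * ?T $$ (j, j'))"
        unfolding cip_def sum_distrib_right by (rule sum_rotate[symmetric])
      also have "\<dots> = (\<Sum>j<dR. \<Sum>j'<dR. (if j = j' then 1 else 0) * ?T $$ (j, j'))"
        by (rule sum.cong[OF refl], rule sum.cong[OF refl]) (use W_orth i in auto)
      also have "\<dots> = mat_trace ?T"
        unfolding mat_trace_def post_op_dim
        by (rule sum.cong[OF refl]) (simp only: sum_delta_lessThan lessThan_iff)
      finally show "(\<Sum>a<dA. \<Sum>j<dR. \<Sum>j'<dR. W i j a * cnj (W i j' a) * ?T $$ (j, j')) = mat_trace ?T" .
    qed
    also have "\<dots> = complex_of_real (\<Sum>i<t. d i) * mat_trace ?T" by (simp add: sum_distrib_right)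
    finally have p: "outcome_prob dA \<rho> F = outcome_prob dR (ket_bra \<psi>) F"
      using outcome_prob_eq[OF \<rho> F] outcome_prob_eq[OF \<psi>c F] d_sum by simp
    moreover have "entropy \<rho> \<le> entropy (post_state dA dB \<rho> F)" if nz: "outcome_prob dA \<rho> F \<noteq> 0"
    proof -
      have dens: "density_mat dR (post_state dR dB (ket_bra \<psi>) F)"
        using density_post_state[OF \<psi>c \<psi>_ens psd] nz p by simp
      have "entropy (post_state dA dB \<rho> F) = (\<Sum>i<t. eta (d i)) + entropy (post_state dR dB (ket_bra \<psi>) F)"
      proof (rule entropy_tensor[OF post_state_carrier dens _ W_orth d_pos d_sum])
        fix a a' assume a: "a < dA" "a' < dA"
        show "post_state dA dB \<rho> F $$ (a, a') = (\<Sum>i<t. complex_of_real (d i) *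
          (\<Sum>j<dR. \<Sum>j'<dR. W i j a * cnj (W i j' a') * post_state dR dB (ket_bra \<psi>) F $$ (j, j')))"
          unfolding post_state_index[OF a] op[OF a] sum_distrib_left
          by (intro sum.cong refl) (simp add: post_state_index p)
      qed
      then show ?thesis using entropy_nonneg[OF dens] ensemble_entropy[OF \<rho> ens] by simp
    qed
    ultimately show ?thesis by blast
  qed
  let ?Q = "{i. i < n \<and> outcome_prob dA \<rho> (E i) \<noteq> 0}"
  have psd: "psd_mat dB (E i)" if "i < n" for i using E that by (simp add: povm_def)
  have "entropy \<rho> = (\<Sum>i\<in>?Q. outcome_prob dA \<rho> (E i) * entropy \<rho>)"
    using outcome_prob_sum[OF \<rho> ens E] by (simp add: sum_distrib_right[symmetric])
  also have "\<dots> \<le> (\<Sum>i\<in>?Q. outcome_prob dA \<rho> (E i) * entropy (post_state dA dB \<rho> (E i)))"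
    by (intro sum_mono mult_left_mono) (use step psd outcome_prob_nonneg[OF \<rho> ens] in auto)
  finally show ?thesis by (simp add: information_gain_def)
qed

text \<open>
  The reduced state on A factors through V, so its invertibility gives V a right inverse, which is
  the adjoint of V. Comparing the traces of \<open>V V*\<close> and \<open>V* V\<close> yields \<open>dA = dL * dR\<close>.
\<close>

lemma full_support_decomposition:
  assumes dec: "subspace_tensor_decomposition dA dL dR V" and pure: "state_times_pure dL dR dB V \<rho>"
    and inv: "invertible_mat (ptrace_B dA dB \<rho>)"
  shows "tensor_decomposition dA dL dR V"
proof -
  have V: "V \<in> carrier_mat dA (dL * dR)" and iso: "mat_adjoint V * V = 1\<^sub>m (dL * dR)"
    using dec by (auto simp: subspace_tensor_decomposition_def isometry_mat_def)
  obtain \<sigma> \<psi> where \<sigma>: "density_mat dL \<sigma>" and \<psi>_unit: "unit_vector (dR * dB) \<psi>"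
    and \<rho>_eq: "\<rho> = kron V (1\<^sub>m dB) * kron \<sigma> (ket_bra \<psi>) * mat_adjoint (kron V (1\<^sub>m dB))"
    using pure by (auto simp: state_times_pure_def)
  have \<sigma>c: "\<sigma> \<in> carrier_mat dL dL" using \<sigma> by (simp add: density_mat_def psd_mat_def)
  have \<psi>: "\<psi> \<in> carrier_vec (dR * dB)" using \<psi>_unit by (auto simp: unit_vector_def)
  let ?F = "tensor_embed dR dB V \<psi>" and ?R = "ptrace_B dA dB \<rho>"
  have R: "?R \<in> carrier_mat dA dA" by (simp add: ptrace_B_def)
  \<comment> \<open>All factors of the reduced state to the right of the leftmost \<open>V\<close>,
    after tracing out B.\<close>
  define Z where "Z = mat (dL * dR) dA (\<lambda>(x, a'). \<Sum>b<dB. \<Sum>k'<dL.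
    \<sigma> $$ (x div dR, k') * \<psi> $ ((x mod dR) * dB + b) * cnj (?F k' a' b))"
  have Z: "Z \<in> carrier_mat (dL * dR) dA" by (simp add: Z_def)
  have "?R = V * Z"
  proof (rule eq_matI)
    fix a a' assume "a < dim_row (V * Z)" "a' < dim_col (V * Z)"
    then have a: "a < dA" "a' < dA" using V Z by auto
    have "(V * Z) $$ (a, a') = (\<Sum>k<dL. \<Sum>j<dR. V $$ (a, k * dR + j) * Z $$ (k * dR + j, a'))"
      unfolding mat_mult_index[OF V Z a] by (rule sum_prod_index)
    also have "\<dots> = (\<Sum>k<dL. \<Sum>j<dR. \<Sum>b<dB. (V $$ (a, k * dR + j) * \<psi> $ (j * dB + b)) *
        (\<Sum>k'<dL. \<sigma> $$ (k, k') * cnj (?F k' a' b)))"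
    proof (rule sum.cong[OF refl], rule sum.cong[OF refl])
      fix k j assume "k \<in> {..<dL}" "j \<in> {..<dR}"
      then have "Z $$ (k * dR + j, a') = (\<Sum>b<dB. \<Sum>k'<dL. \<sigma> $$ (k, k') * \<psi> $ (j * dB + b) * cnj (?F k' a' b))"
        using a prod_index_less[of k dL j dR] by (simp add: Z_def)
      then show "V $$ (a, k * dR + j) * Z $$ (k * dR + j, a') =
        (\<Sum>b<dB. (V $$ (a, k * dR + j) * \<psi> $ (j * dB + b)) * (\<Sum>k'<dL. \<sigma> $$ (k, k') * cnj (?F k' a' b)))"
        by (simp add: sum_distrib_left mult_ac)
    qed
    also have "\<dots> = (\<Sum>b<dB. \<Sum>k<dL. \<Sum>j<dR. (V $$ (a, k * dR + j) * \<psi> $ (j * dB + b)) *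
        (\<Sum>k'<dL. \<sigma> $$ (k, k') * cnj (?F k' a' b)))"
      by (rule sum_rotate)
    also have "\<dots> = (\<Sum>b<dB. \<Sum>k<dL. ?F k a b * (\<Sum>k'<dL. \<sigma> $$ (k, k') * cnj (?F k' a' b)))"
      unfolding tensor_embed_def[of dR dB V \<psi> _ a] by (simp only: sum_distrib_right)
    also have "\<dots> = ?R $$ (a, a')"
      using a \<rho>_eq state_times_pure_index[OF V \<sigma>c \<psi>]
      by (simp add: ptrace_B_def sum_distrib_left mult_ac)
    finally show "?R $$ (a, a') = (V * Z) $$ (a, a')" ..
  qed (use V Z R in auto)
  moreover obtain B where B: "inverts_mat ?R B" "inverts_mat B ?R" using inv by (auto simp: invertible_mat_def)
  have RB: "?R * B = 1\<^sub>m dA" using B(1) R by (simp add: inverts_mat_def)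
  \<comment> \<open>\<open>inverts_mat\<close> fixes no dimensions for \<open>B\<close>; they are
    read off from the column counts of the two identities.\<close>
  have Bc: "B \<in> carrier_mat dA dA"
  proof
    show "dim_col B = dA" using arg_cong[OF RB, of dim_col] by simp
    have "B * ?R = 1\<^sub>m (dim_row B)" using B(2) by (simp add: inverts_mat_def)
    from arg_cong[OF this, of dim_col] show "dim_row B = dA" using R by simp
  qed
  ultimately have VZB: "V * (Z * B) = 1\<^sub>m dA" using RB assoc_mult_mat[OF V Z Bc] by simp
  have A: "mat_adjoint V \<in> carrier_mat (dL * dR) dA" using V by auto
  have ZB: "Z * B \<in> carrier_mat (dL * dR) dA" using Z Bc by auto
  have "Z * B = mat_adjoint V * V * (Z * B)" unfolding iso using left_mult_one_mat[OF ZB] by simp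
  also have "\<dots> = mat_adjoint V" unfolding assoc_mult_mat[OF A V ZB] VZB using right_mult_one_mat[OF A] .
  finally have VV: "V * mat_adjoint V = 1\<^sub>m dA" using VZB by simp
  have "complex_of_nat dA = (\<Sum>a<dA. (V * mat_adjoint V) $$ (a, a))" unfolding VV by simp
  also have "\<dots> = (\<Sum>a<dA. \<Sum>x<dL * dR. V $$ (a, x) * cnj (V $$ (a, x)))"
    by (rule sum.cong[OF refl], subst mat_mult_index[OF V A]) (use V in auto)
  also have "\<dots> = (\<Sum>x<dL * dR. cip dA (\<lambda>a. V $$ (a, x)) (\<lambda>a. V $$ (a, x)))"
    unfolding cip_def by (rule sum.swap)
  also have "\<dots> = complex_of_nat (dL * dR)"
    using isometry_columns[OF V] dec by (simp add: subspace_tensor_decomposition_def)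
  finally have "dA = dL * dR" using of_nat_eq_iff by blast
  then show ?thesis using V iso VV by (simp add: tensor_decomposition_def unitary_mat_def)
qed

lemma tensor_decomposition_subspace:
  "tensor_decomposition dA dL dR V \<Longrightarrow> subspace_tensor_decomposition dA dL dR V"
  by (auto simp: tensor_decomposition_def subspace_tensor_decomposition_def unitary_mat_def isometry_mat_def)

theorem theorem1:
  fixes dA dB :: nat and \<rho> :: "complex mat"
  assumes "density_mat (dA * dB) \<rho>"
  shows "discord dA dB \<rho> \<le> entropy (ptrace_A dA dB \<rho>) \<and>
    (discord dA dB \<rho> = entropy (ptrace_A dA dB \<rho>) \<longleftrightarrow>
       (\<exists>dL dR V. subspace_tensor_decomposition dA dL dR V \<and> state_times_pure dL dR dB V \<rho>)) \<and>
    (invertible_mat (ptrace_B dA dB \<rho>) \<longrightarrow>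
       (discord dA dB \<rho> = entropy (ptrace_A dA dB \<rho>) \<longleftrightarrow>
         (\<exists>dL dR V. tensor_decomposition dA dL dR V \<and> state_times_pure dL dR dB V \<rho>)))"
proof -
  have \<rho>: "\<rho> \<in> carrier_mat (dA * dB) (dA * dB)"
    using assms by (simp add: density_mat_def psd_mat_def)
  obtain r l M where ens: "ensemble dA dB \<rho> r l M" and ent: "entropy \<rho> = (\<Sum>k<r. eta (l k))"
    using assms by (rule density_ensemble)
  let ?G = "{information_gain dA dB \<rho> n E | n E. povm dB n E}"
  let ?bound = "entropy (ptrace_B dA dB \<rho>) - entropy \<rho>"
  let ?dec = "\<exists>dL dR V. subspace_tensor_decomposition dA dL dR V \<and> state_times_pure dL dR dB V \<rho>"
  \<comment> \<open>S(B) is split off, so that both claims become comparisons of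
    \<open>Sup ?G\<close> with \<open>?bound\<close>.\<close>
  have discord: "discord dA dB \<rho> = entropy (ptrace_A dA dB \<rho>) + (?bound - Sup ?G)"
    by (simp add: discord_def mutual_information_def classical_correlation_def)
  have bdd: "bdd_above ?G" by (rule bdd_above_information_gain[OF \<rho> ens])
  \<comment> \<open>One basis suffices for the bound. The standard one also shows that the set of
    gains is nonempty, as \<open>cSup_least\<close> requires in the converse.\<close>
  have std: "onb dB (\<lambda>i a. if i = a then 1 else 0)"
    by (rule onbI) (simp add: cip_def sum_delta_lessThan)
  let ?E = "\<lambda>i. mat dB dB (\<lambda>(b, c). (if i = b then 1 else 0) * cnj (if i = c then 1 else 0))"
  have std_gain: "information_gain dA dB \<rho> dB ?E \<in> ?G" using povm_onb[OF std] by blast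
  have "?bound \<le> information_gain dA dB \<rho> dB ?E"
    unfolding ent by (rule rank_one_measurement(1)[OF \<rho> ens std])
  also have "\<dots> \<le> Sup ?G" using std_gain bdd by (rule cSup_upper)
  finally have lower: "?bound \<le> Sup ?G" .
  have iff: "discord dA dB \<rho> = entropy (ptrace_A dA dB \<rho>) \<longleftrightarrow> ?dec"
  proof
    assume "discord dA dB \<rho> = entropy (ptrace_A dA dB \<rho>)"
    then have "Sup ?G = ?bound" unfolding discord by simp
    \<comment> \<open>A supremum equal to \<open>?bound\<close> caps the gain of every measurement,
      attained or not. Together with the opposite inequality for bases this produces the equality
      case in each of them.\<close>
    then have "information_gain dA dB \<rho> n E \<le> entropy (ptrace_B dA dB \<rho>) - (\<Sum>k<r. eta (l k))"
      if "povm dB n E" for n E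
      using cSup_upper[OF _ bdd, of "information_gain dA dB \<rho> n E"] that ent by auto
    from vanishing_correlation[OF \<rho> ens this] show ?dec
      by (intro correlation_free_decomposition[OF \<rho> ens]) auto
  next
    assume ?dec
    then have "information_gain dA dB \<rho> n E \<le> ?bound" if "povm dB n E" for n E
      using information_gain_state_times_pure[OF \<rho> _ _ that] by blast
    then have "Sup ?G \<le> ?bound" using std_gain by (intro cSup_least) auto
    then show "discord dA dB \<rho> = entropy (ptrace_A dA dB \<rho>)" using lower unfolding discord by simp
  qed
  moreover have "?dec \<longleftrightarrow> (\<exists>dL dR V. tensor_decomposition dA dL dR V \<and> state_times_pure dL dR dB V \<rho>)"
    if "invertible_mat (ptrace_B dA dB \<rho>)"
    using full_support_decomposition[OF _ _ that] tensor_decomposition_subspace by blast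
  moreover have "discord dA dB \<rho> \<le> entropy (ptrace_A dA dB \<rho>)" using lower unfolding discord by simp
  ultimately show ?thesis by blast
qed

end
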